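(* Let $\mathbb{K}$ be a field. Assume that the following holds: two sharp tridiagonal systems over $\mathbb{K}$ are isomorphic if and only if they have the same parameter array. Let $\Phi=(A;\{E_i\}_{i=0}^d;A^*;\{E^*_i\}_{i=0}^d)$ be a sharp tridiagonal system on a $\mathbb{K}$-vector space $V$ of finite positive dimension. Then there exists a nonzero bilinear form $\langle\,,\rangle$ on $V$ such that $$\langle Au,v\rangle=\langle u,Av\rangle,\qquad \langle A^*u,v\rangle=\langle u,A^*v\rangle\qquad\text{for all }u,v\in V.$$ This form is unique up to multiplication by a nonzero scalar in $\mathbb{K}$. This form is nondegenerate and symmetric.
   Context: $\mathbb{K}$ is a field and all vector spaces $V$ are over $\mathbb{K}$ with finite positive dimension; $\mathrm{End}(V)$ is the algebra of $\mathbb{K}$-linear maps $V\to V$, with identity $I$. "Diagonalizable" means $V$ is spanned by the eigenspaces. A tridiagonal pair on $V$ is an ordered pair $A,A^*\in\mathrm{End}(V)$ ($A^*$ is just a name, not an adjoint) such that: (i) each of $A,A^*$ is diagonalizable; (ii) there is an ordering $\{V_i\}_{i=0}^d$ of the eigenspaces of $A$ with $A^*V_i\subseteq V_{i-1}+V_i+V_{i+1}$ for $0\le i\le d$ (where $V_{-1}=V_{d+1}=0$); (iii) there is an ordering $\{V^*_i\}_{i=0}^\delta$ of the eigenspaces of $A^*$ with $AV^*_i\subseteq V^*_{i-1}+V^*_i+V^*_{i+1}$ for $0\le i\le\delta$ (where $V^*_{-1}=V^*_{\delta+1}=0$); (iv) no subspace $W$ with $0\ne W\ne V$ satisfies $AW\subseteq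 W$ and $A^*W\subseteq W$. Orderings as in (ii), (iii) are called standard. It is known that $d=\delta$ and that $V_i,V_{d-i},V^*_i,V^*_{d-i}$ all have the same dimension for $0\le i\le d$. A tridiagonal system on $V$ (or over $\mathbb{K}$) is a sequence $\Phi=(A;\{E_i\}_{i=0}^d;A^*;\{E^*_i\}_{i=0}^d)$ where $A,A^*$ is a tridiagonal pair on $V$ and $\{E_i\}$ (resp. $\{E^*_i\}$) are the primitive idempotents (projections onto the eigenspaces along the other eigenspaces) of $A$ (resp. $A^*$), ordered so that the eigenspaces $\{E_iV\}$ (resp. $\{E^*_iV\}$) are in a standard order. $\theta_i$ (resp. $\theta^*_i$) is the eigenvalue of $A$ (resp. $A^*$) on $E_iV$ (resp. $E^*_iV$). $\Phi$ is sharp if $\dim E_0V=1$ (equivalently $\dim E^*_0V=1$). Split sequence: let $U_i=(E^*_0V+\cdots+E^*_iV)\cap(E_iV+\cdots+E_dV)$ for $0\le i\le d$. It is known that $V=U_0+\cdots+U_d$ is a direct sum, $U_0=E_0^*V$, $(A-\theta_iI)U_i\subseteq U_{i+1}$ and $(A^*-\theta^*_iI)U_i\subseteq U_{i-1}$ ($U_{-1}=U_{d+1}=0$). If $\Phi$ is sharp, $\dim U_0=1$ and $U_0$ is invariant under $(A^*-\theta^*_1I)\cdots(A^*-\theta^*_iI)(A-\theta_{i-1}I)\cdots(A-\theta_1I)(A-\theta_0I)$; the corresponding eigenvalue is $\zeta_i$, and $\{\zeta_i\}_{i=0}^d$ is the split sequence of $\Phi$. The parameter array of a sharp $\Phi$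 is $(\{\theta_i\}_{i=0}^d;\{\theta^*_i\}_{i=0}^d;\{\zeta_i\}_{i=0}^d)$. Tridiagonal systems $\Phi$ on $V$ and $\Phi'=(B;\{F_i\}_{i=0}^d;B^*;\{F^*_i\}_{i=0}^d)$ on $V'$ are isomorphic if there is a $\mathbb{K}$-algebra isomorphism $\sigma:\mathrm{End}(V)\to\mathrm{End}(V')$ with $\sigma(A)=B$, $\sigma(A^* )=B^*$, $\sigma(E_i)=F_i$, $\sigma(E^*_i)=F^*_i$ for $0\le i\le d$. A bilinear form on $V$ is a bilinear map $V\times V\to\mathbb{K}$. *)

theory Defs
  imports Complex_Main "HOL-Library.Function_Algebras" "HOL-Library.FuncSet"
begin

text \<open>
  A vector space over a field is a subspace \<open>V\<close> of an ambient space given by a scalar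
  multiplication \<open>s\<close> in the sense of the library locale \<open>vector_space\<close>; taking \<open>V = UNIV\<close> gives
  the ambient space itself. The carrier \<open>V\<close> is explicit so that one can quantify over spaces of
  varying dimension inside a formula. The last two conjuncts say that the dimension of
  \<open>V\<close> is finite and positive.
\<close>

definition fd_space :: "('k::field \<Rightarrow> 'v::ab_group_add \<Rightarrow> 'v) \<Rightarrow> 'v set \<Rightarrow> bool" where
  "fd_space s V \<longleftrightarrow>
     vector_space s \<and> module.subspace s V \<and>
     (\<exists>B. finite B \<and> module.span s B = V) \<and> V \<noteq> {0}"

text \<open>
  Linear maps \<open>V \<rightarrow> V\<close> are extensional functions (value \<open>undefined\<close> outside \<open>V\<close>), so that
  equality in \<open>End_on s V\<close> is equality of maps on \<open>V\<close>.
\<close>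

definition End_on :: "('k::field \<Rightarrow> 'v::ab_group_add \<Rightarrow> 'v) \<Rightarrow> 'v set \<Rightarrow> ('v \<Rightarrow> 'v) set" where
  "End_on s V =
     {f \<in> V \<rightarrow>\<^sub>E V. (\<forall>u\<in>V. \<forall>v\<in>V. f (u + v) = f u + f v) \<and> (\<forall>c. \<forall>v\<in>V. f (s c v) = s c (f v))}"

definition End_iso ::
  "('k::field \<Rightarrow> 'v::ab_group_add \<Rightarrow> 'v) \<Rightarrow> 'v set \<Rightarrow>
   ('k \<Rightarrow> 'w::ab_group_add \<Rightarrow> 'w) \<Rightarrow> 'w set \<Rightarrow> (('v \<Rightarrow> 'v) \<Rightarrow> 'w \<Rightarrow> 'w) \<Rightarrow> bool" where
  "End_iso s V s' V' \<sigma> \<longleftrightarrow>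
     bij_betw \<sigma> (End_on s V) (End_on s' V') \<and>
     (\<forall>f\<in>End_on s V. \<forall>g\<in>End_on s V.
        \<sigma> (\<lambda>v\<in>V. f v + g v) = (\<lambda>w\<in>V'. \<sigma> f w + \<sigma> g w)) \<and>
     (\<forall>c. \<forall>f\<in>End_on s V. \<sigma> (\<lambda>v\<in>V. s c (f v)) = (\<lambda>w\<in>V'. s' c (\<sigma> f w))) \<and>
     (\<forall>f\<in>End_on s V. \<forall>g\<in>End_on s V. \<sigma> (compose V f g) = compose V' (\<sigma> f) (\<sigma> g)) \<and>
     \<sigma> (\<lambda>v\<in>V. v) = (\<lambda>w\<in>V'. w)"

definition eigenspaces ::
  "('k::field \<Rightarrow> 'v::ab_group_add \<Rightarrow> 'v) \<Rightarrow> 'v set \<Rightarrow> ('v \<Rightarrow> 'v) \<Rightarrow> 'v set set" where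
  "eigenspaces s V f = {W. \<exists>t. W = {v\<in>V. f v = s t v} \<and> W \<noteq> {0}}"

definition diagonalizable ::
  "('k::field \<Rightarrow> 'v::ab_group_add \<Rightarrow> 'v) \<Rightarrow> 'v set \<Rightarrow> ('v \<Rightarrow> 'v) \<Rightarrow> bool" where
  "diagonalizable s V f \<longleftrightarrow> module.span s (\<Union>(eigenspaces s V f)) = V"

text \<open>
  Sums of subspaces are written as spans of unions. Restricting the index \<open>j\<close> to
  \<open>{0..d}\<close> implements the convention that the members of the sequence with index \<open>-1\<close> and
  \<open>d + 1\<close> are zero.
\<close>

definition standard_ordering ::
  "('k::field \<Rightarrow> 'v::ab_group_add \<Rightarrow> 'v) \<Rightarrow> 'v set \<Rightarrow> ('v \<Rightarrow> 'v) \<Rightarrow> ('v \<Rightarrow> 'v) \<Rightarrow>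
   nat \<Rightarrow> (nat \<Rightarrow> 'v set) \<Rightarrow> bool" where
  "standard_ordering s V f g d W \<longleftrightarrow>
     bij_betw W {0..d} (eigenspaces s V f) \<and>
     (\<forall>i\<le>d. g ` W i \<subseteq> module.span s (\<Union>j\<in>{j. j \<le> d \<and> i \<le> j + 1 \<and> j \<le> i + 1}. W j))"

definition tridiagonal_pair ::
  "('k::field \<Rightarrow> 'v::ab_group_add \<Rightarrow> 'v) \<Rightarrow> 'v set \<Rightarrow> ('v \<Rightarrow> 'v) \<Rightarrow> ('v \<Rightarrow> 'v) \<Rightarrow> bool" where
  "tridiagonal_pair s V A As \<longleftrightarrow>
     A \<in> End_on s V \<and> As \<in> End_on s V \<and>
     diagonalizable s V A \<and> diagonalizable s V As \<and>
     (\<exists>d W. standard_ordering s V A As d W) \<and>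
     (\<exists>\<delta> W. standard_ordering s V As A \<delta> W) \<and>
     \<not> (\<exists>W. module.subspace s W \<and> W \<subseteq> V \<and> W \<noteq> {0} \<and> W \<noteq> V \<and> A ` W \<subseteq> W \<and> As ` W \<subseteq> W)"

definition primitive_idempotents ::
  "('k::field \<Rightarrow> 'v::ab_group_add \<Rightarrow> 'v) \<Rightarrow> 'v set \<Rightarrow> ('v \<Rightarrow> 'v) \<Rightarrow> ('v \<Rightarrow> 'v) set" where
  "primitive_idempotents s V f =
     {E \<in> End_on s V. \<exists>W\<in>eigenspaces s V f.
        (\<forall>v\<in>W. E v = v) \<and> (\<forall>W'\<in>eigenspaces s V f - {W}. \<forall>v\<in>W'. E v = 0)}"

text \<open>
  The data \<open>(A; E\<^sub>0, \<dots>, E\<^sub>d; A\<^sup>*; E\<^sup>*\<^sub>0, \<dots>, E\<^sup>*\<^sub>d)\<close>; the suffix \<open>s\<close> stands for the star. Values of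
  the two sequences at indices above \<open>diam\<close> are irrelevant to all notions below.
\<close>

record 'v td_data =
  diam :: nat
  opA :: "'v \<Rightarrow> 'v"
  idE :: "nat \<Rightarrow> 'v \<Rightarrow> 'v"
  opAs :: "'v \<Rightarrow> 'v"
  idEs :: "nat \<Rightarrow> 'v \<Rightarrow> 'v"

definition td_system ::
  "('k::field \<Rightarrow> 'v::ab_group_add \<Rightarrow> 'v) \<Rightarrow> 'v set \<Rightarrow> 'v td_data \<Rightarrow> bool" where
  "td_system s V \<Phi> \<longleftrightarrow>
     tridiagonal_pair s V (opA \<Phi>) (opAs \<Phi>) \<and>
     bij_betw (idE \<Phi>) {0..diam \<Phi>} (primitive_idempotents s V (opA \<Phi>)) \<and>
     bij_betw (idEs \<Phi>) {0..diam \<Phi>} (primitive_idempotents s V (opAs \<Phi>)) \<and>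
     standard_ordering s V (opA \<Phi>) (opAs \<Phi>) (diam \<Phi>) (\<lambda>i. idE \<Phi> i ` V) \<and>
     standard_ordering s V (opAs \<Phi>) (opA \<Phi>) (diam \<Phi>) (\<lambda>i. idEs \<Phi> i ` V)"

definition sharp_td_system ::
  "('k::field \<Rightarrow> 'v::ab_group_add \<Rightarrow> 'v) \<Rightarrow> 'v set \<Rightarrow> 'v td_data \<Rightarrow> bool" where
  "sharp_td_system s V \<Phi> \<longleftrightarrow> td_system s V \<Phi> \<and> vector_space.dim s (idE \<Phi> 0 ` V) = 1"

definition eigenvalue_on ::
  "('k::field \<Rightarrow> 'v::ab_group_add \<Rightarrow> 'v) \<Rightarrow> 'v set \<Rightarrow> ('v \<Rightarrow> 'v) \<Rightarrow> 'k" where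
  "eigenvalue_on s W f = (THE t. \<forall>w\<in>W. f w = s t w)"

definition theta ::
  "('k::field \<Rightarrow> 'v::ab_group_add \<Rightarrow> 'v) \<Rightarrow> 'v set \<Rightarrow> 'v td_data \<Rightarrow> nat \<Rightarrow> 'k" where
  "theta s V \<Phi> i = eigenvalue_on s (idE \<Phi> i ` V) (opA \<Phi>)"

definition theta_s ::
  "('k::field \<Rightarrow> 'v::ab_group_add \<Rightarrow> 'v) \<Rightarrow> 'v set \<Rightarrow> 'v td_data \<Rightarrow> nat \<Rightarrow> 'k" where
  "theta_s s V \<Phi> i = eigenvalue_on s (idEs \<Phi> i ` V) (opAs \<Phi>)"

definition split_component ::
  "('k::field \<Rightarrow> 'v::ab_group_add \<Rightarrow> 'v) \<Rightarrow> 'v set \<Rightarrow> 'v td_data \<Rightarrow> nat \<Rightarrow> 'v set" where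
  "split_component s V \<Phi> i =
     module.span s (\<Union>j\<in>{0..i}. idEs \<Phi> j ` V) \<inter>
     module.span s (\<Union>j\<in>{i..diam \<Phi>}. idE \<Phi> j ` V)"

text \<open>
  The \<open>foldr\<close> expressions are the operator products
  \<open>(A\<^sup>* - \<theta>\<^sup>*\<^sub>1 I) \<cdots> (A\<^sup>* - \<theta>\<^sup>*\<^sub>i I)\<close> and
  \<open>(A - \<theta>\<^sub>i\<^sub>-\<^sub>1 I) \<cdots> (A - \<theta>\<^sub>1 I) (A - \<theta>\<^sub>0 I)\<close>, with the rightmost factor acting first.
\<close>

definition split_operator ::
  "('k::field \<Rightarrow> 'v::ab_group_add \<Rightarrow> 'v) \<Rightarrow> 'v set \<Rightarrow> 'v td_data \<Rightarrow> nat \<Rightarrow> 'v \<Rightarrow> 'v" where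
  "split_operator s V \<Phi> i v =
     foldr (\<lambda>j u. opAs \<Phi> u - s (theta_s s V \<Phi> j) u) [1..<Suc i]
       (foldr (\<lambda>j u. opA \<Phi> u - s (theta s V \<Phi> j) u) (rev [0..<i]) v)"

definition zeta ::
  "('k::field \<Rightarrow> 'v::ab_group_add \<Rightarrow> 'v) \<Rightarrow> 'v set \<Rightarrow> 'v td_data \<Rightarrow> nat \<Rightarrow> 'k" where
  "zeta s V \<Phi> i = eigenvalue_on s (split_component s V \<Phi> 0) (split_operator s V \<Phi> i)"

definition parameter_array ::
  "('k::field \<Rightarrow> 'v::ab_group_add \<Rightarrow> 'v) \<Rightarrow> 'v set \<Rightarrow> 'v td_data \<Rightarrow> 'k list \<times> 'k list \<times> 'k list" where
  "parameter_array s V \<Phi> =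
     (map (theta s V \<Phi>) [0..<Suc (diam \<Phi>)],
      map (theta_s s V \<Phi>) [0..<Suc (diam \<Phi>)],
      map (zeta s V \<Phi>) [0..<Suc (diam \<Phi>)])"

definition td_isomorphic ::
  "('k::field \<Rightarrow> 'v::ab_group_add \<Rightarrow> 'v) \<Rightarrow> 'v set \<Rightarrow> 'v td_data \<Rightarrow>
   ('k \<Rightarrow> 'w::ab_group_add \<Rightarrow> 'w) \<Rightarrow> 'w set \<Rightarrow> 'w td_data \<Rightarrow> bool" where
  "td_isomorphic s V \<Phi> s' V' \<Phi>' \<longleftrightarrow>
     diam \<Phi> = diam \<Phi>' \<and>
     (\<exists>\<sigma>. End_iso s V s' V' \<sigma> \<and>
          \<sigma> (opA \<Phi>) = opA \<Phi>' \<and> \<sigma> (opAs \<Phi>) = opAs \<Phi>' \<and>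
          (\<forall>i\<le>diam \<Phi>. \<sigma> (idE \<Phi> i) = idE \<Phi>' i \<and> \<sigma> (idEs \<Phi> i) = idEs \<Phi>' i))"

text \<open>
  Sequences over \<open>'k\<close> with pointwise operations. Since this space has infinite dimension, every
  vector space over \<open>'k\<close> of finite dimension is isomorphic to one of its subspaces, so
  quantifying over these subspaces amounts to quantifying over all vector spaces of finite
  dimension over \<open>'k\<close> (a quantifier over types is not available inside a formula).
\<close>

definition seq_scale :: "'k::field \<Rightarrow> (nat \<Rightarrow> 'k) \<Rightarrow> nat \<Rightarrow> 'k" where
  "seq_scale c x = (\<lambda>n. c * x n)"

lemma vector_space_seq_scale: "vector_space (seq_scale :: 'k::field \<Rightarrow> _)"
  by unfold_locales (auto simp: seq_scale_def fun_eq_iff algebra_simps)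

definition bilinear_form ::
  "('k::field \<Rightarrow> 'v::ab_group_add \<Rightarrow> 'v) \<Rightarrow> 'v set \<Rightarrow> ('v \<Rightarrow> 'v \<Rightarrow> 'k) \<Rightarrow> bool" where
  "bilinear_form s V b \<longleftrightarrow>
     (\<forall>u\<in>V. \<forall>v\<in>V. \<forall>w\<in>V. b (u + v) w = b u w + b v w \<and> b w (u + v) = b w u + b w v) \<and>
     (\<forall>c. \<forall>u\<in>V. \<forall>v\<in>V. b (s c u) v = c * b u v \<and> b u (s c v) = c * b u v)"

definition nondegenerate_form :: "'v::ab_group_add set \<Rightarrow> ('v \<Rightarrow> 'v \<Rightarrow> 'k::field) \<Rightarrow> bool" where
  "nondegenerate_form V b \<longleftrightarrow>
     (\<forall>u\<in>V. (\<forall>v\<in>V. b u v = 0) \<longrightarrow> u = 0) \<and> (\<forall>v\<in>V. (\<forall>u\<in>V. b u v = 0) \<longrightarrow> v = 0)"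

definition symmetric_form :: "'v set \<Rightarrow> ('v \<Rightarrow> 'v \<Rightarrow> 'k) \<Rightarrow> bool" where
  "symmetric_form V b \<longleftrightarrow> (\<forall>u\<in>V. \<forall>v\<in>V. b u v = b v u)"

definition nonzero_invariant_form ::
  "('k::field \<Rightarrow> 'v::ab_group_add \<Rightarrow> 'v) \<Rightarrow> 'v set \<Rightarrow> 'v td_data \<Rightarrow> ('v \<Rightarrow> 'v \<Rightarrow> 'k) \<Rightarrow> bool" where
  "nonzero_invariant_form s V \<Phi> b \<longleftrightarrow>
     bilinear_form s V b \<and> (\<exists>u\<in>V. \<exists>v\<in>V. b u v \<noteq> 0) \<and>
     (\<forall>u\<in>V. \<forall>v\<in>V. b (opA \<Phi> u) v = b u (opA \<Phi> v) \<and> b (opAs \<Phi> u) v = b u (opAs \<Phi> v))"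

end

theory Submission
  imports Defs
begin

text \<open>
  Transposing a sharp tridiagonal system with respect to a perfect pairing gives a sharp tridiagonal
  system on the dual space with the same parameter array: \<open>E\<^sup>*\<^sub>0V\<close> is a line, and \<open>\<zeta>\<^sub>i\<close> equals
  \<open>(\<theta>\<^sup>*\<^sub>0 - \<theta>\<^sup>*\<^sub>1) \<cdots> (\<theta>\<^sup>*\<^sub>0 - \<theta>\<^sup>*\<^sub>i)\<close> times the scalar by which
  \<open>E\<^sup>*\<^sub>0 (A - \<theta>\<^sub>i\<^sub>-\<^sub>1 I) \<cdots> (A - \<theta>\<^sub>0 I) E\<^sup>*\<^sub>0\<close> acts on that line. By hypothesis the system and its transpose are
  isomorphic, and a linear map from \<open>V\<close> to its dual that intertwines them is the same thing as an
  invariant form. The radical of an invariant form is invariant under \<open>A\<close> and \<open>A\<^sup>*\<close>, hence trivial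
  by irreducibility. If \<open>e\<close> spans \<open>E\<^sup>*\<^sub>0V\<close> then an invariant form \<open>b\<close> with \<open>b e e = 0\<close> vanishes; applied to
  differences of forms this yields both uniqueness and symmetry.

  Coordinates identify \<open>V\<close> with a space of sequences, where the hypothesis applies. The
  system obtained there by transport of structure is realised as the transpose of the transpose.
\<close>

section \<open>Spectral resolutions\<close>

locale carrier_space = vector_space s
  for s :: "'k::field \<Rightarrow> 'v::ab_group_add \<Rightarrow> 'v" +
  fixes V :: "'v set"
  assumes subspace_V: "subspace V"
begin

lemma V_zero [simp]: "0 \<in> V"
  and V_add: "u \<in> V \<Longrightarrow> v \<in> V \<Longrightarrow> u + v \<in> V"
  and V_diff: "u \<in> V \<Longrightarrow> v \<in> V \<Longrightarrow> u - v \<in> V"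
  and V_scale: "v \<in> V \<Longrightarrow> s c v \<in> V"
  and V_sum: "(\<And>i. i \<in> I \<Longrightarrow> f i \<in> V) \<Longrightarrow> sum f I \<in> V"
  using subspace_V by (auto intro: subspace_0 subspace_add subspace_diff subspace_scale subspace_sum)

lemmas V_closed = V_zero V_add V_diff V_scale V_sum

lemma End_on_in: "f \<in> End_on s V \<Longrightarrow> v \<in> V \<Longrightarrow> f v \<in> V"
  and End_on_add: "f \<in> End_on s V \<Longrightarrow> u \<in> V \<Longrightarrow> v \<in> V \<Longrightarrow> f (u + v) = f u + f v"
  and End_on_scale: "f \<in> End_on s V \<Longrightarrow> v \<in> V \<Longrightarrow> f (s c v) = s c (f v)"
  by (auto simp: End_on_def)

lemma End_on_zero: "f \<in> End_on s V \<Longrightarrow> f 0 = 0"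
  using End_on_scale[of f 0 0] by simp

lemma End_on_diff:
  assumes "f \<in> End_on s V" "u \<in> V" "v \<in> V"
  shows "f (u - v) = f u - f v"
  using End_on_add[OF assms(1) V_diff[OF assms(2,3)] assms(3)] by (simp add: algebra_simps)

lemma End_on_sum:
  assumes "f \<in> End_on s V" "\<And>i. i \<in> I \<Longrightarrow> g i \<in> V"
  shows "f (sum g I) = (\<Sum>i\<in>I. f (g i))"
  using assms(2)
proof (induction I rule: infinite_finite_induct)
  case (insert i I)
  then show ?case
    using assms(1) by (simp add: End_on_add V_sum)
qed (simp_all add: End_on_zero[OF assms(1)])

lemma End_onI:
  assumes "f \<in> extensional V" "\<And>v. v \<in> V \<Longrightarrow> f v \<in> V"
    "\<And>u v. u \<in> V \<Longrightarrow> v \<in> V \<Longrightarrow> f (u + v) = f u + f v"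
    "\<And>c v. v \<in> V \<Longrightarrow> f (s c v) = s c (f v)"
  shows "f \<in> End_on s V"
  using assms by (auto simp: End_on_def PiE_def)

lemma subspace_eigenvectors:
  assumes "f \<in> End_on s V"
  shows "subspace {v \<in> V. f v = s t v}"
  using assms
  by (intro subspaceI) (auto simp: End_on_zero End_on_add End_on_scale V_closed algebra_simps)

end

lemma (in vector_space) dim_eq_1_obtain:
  assumes "subspace W" "dim W = 1"
  obtains e where "e \<in> W" "e \<noteq> 0" "W = range (\<lambda>c. scale c e)"
proof -
  obtain B where B: "B \<subseteq> W" "independent B" "W \<subseteq> span B" "card B = dim W"
    using basis_exists by blast
  then obtain e where e: "B = {e}"
    using assms(2) card_1_singletonE by metis
  have "span B = W"
    using B assms(1) span_minimal by blast
  then have "W = range (\<lambda>c. scale c e)"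
    unfolding e span_singleton by (rule sym)
  moreover have "e \<in> W" "e \<noteq> 0"
    using B e by auto
  ultimately show thesis
    by (rule that[rotated 2])
qed

lemma (in vector_space) dim_eq_1I:
  assumes "W = range (\<lambda>c. scale c e)" "e \<noteq> 0"
  shows "dim W = 1"
  using assms dim_span_eq_card_independent[of "{e}"] by (simp add: span_singleton)

text \<open>A diagonalizable map as the sum of the \<open>\<theta> i\<close> times its
  eigenprojections \<open>E i\<close>, recorded by equations tested on vectors. Such equations
  survive transposition, while statements about eigenspaces do not transfer directly.\<close>

locale spectral_resolution = carrier_space s V
  for s :: "'k::field \<Rightarrow> 'v::ab_group_add \<Rightarrow> 'v" and V +
  fixes d :: nat and A :: "'v \<Rightarrow> 'v" and E :: "nat \<Rightarrow> 'v \<Rightarrow> 'v" and \<theta> :: "nat \<Rightarrow> 'k"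
  assumes A_End: "A \<in> End_on s V"
    and E_End: "i \<le> d \<Longrightarrow> E i \<in> End_on s V"
    and E_nonzero: "i \<le> d \<Longrightarrow> \<exists>v\<in>V. E i v \<noteq> 0"
    and inj_theta: "inj_on \<theta> {..d}"
    and E_E: "i \<le> d \<Longrightarrow> j \<le> d \<Longrightarrow> v \<in> V \<Longrightarrow> E i (E j v) = (if i = j then E j v else 0)"
    and sum_E: "v \<in> V \<Longrightarrow> (\<Sum>i\<le>d. E i v) = v"
    and A_E: "i \<le> d \<Longrightarrow> v \<in> V \<Longrightarrow> A (E i v) = s (\<theta> i) (E i v)"
begin

lemmas A_in = End_on_in[OF A_End]
lemmas E_in = End_on_in[OF E_End]
lemmas A_linear = End_on_add[OF A_End] End_on_scale[OF A_End] End_on_zero[OF A_End] End_on_diff[OF A_End]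
lemmas E_linear = End_on_add[OF E_End] End_on_scale[OF E_End] End_on_zero[OF E_End] End_on_diff[OF E_End]

text \<open>Decompose \<open>v\<close> into the components \<open>E j v\<close>, on which
  \<open>A\<close> is scalar; after \<open>E i\<close> is applied only the term \<open>j = i\<close>
  is left.\<close>

lemma E_A:
  assumes "i \<le> d" "v \<in> V"
  shows "E i (A v) = s (\<theta> i) (E i v)"
proof -
  have "E i (A v) = E i (A (\<Sum>j\<le>d. E j v))"
    by (simp add: sum_E assms)
  also have "\<dots> = E i (\<Sum>j\<le>d. s (\<theta> j) (E j v))"
    using assms by (subst End_on_sum[OF A_End]) (auto simp: E_in A_E intro!: arg_cong[where f = "E i"] sum.cong)
  also have "\<dots> = (\<Sum>j\<le>d. s (\<theta> j) (E i (E j v)))"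
    using assms by (subst End_on_sum[OF E_End]) (auto simp: E_in V_scale E_linear intro!: sum.cong)
  also have "\<dots> = (\<Sum>j\<le>d. if i = j then s (\<theta> j) (E j v) else 0)"
    using assms by (intro sum.cong) (auto simp: E_E)
  finally show ?thesis
    using assms by simp
qed

lemma E_fixes_iff:
  assumes "i \<le> d" "v \<in> V"
  shows "E i v = v \<longleftrightarrow> (\<forall>j\<le>d. j \<noteq> i \<longrightarrow> E j v = 0)"
proof
  assume "E i v = v"
  then show "\<forall>j\<le>d. j \<noteq> i \<longrightarrow> E j v = 0"
    using E_E assms by metis
next
  assume "\<forall>j\<le>d. j \<noteq> i \<longrightarrow> E j v = 0"
  then have "(\<Sum>j\<le>d. E j v) = (\<Sum>j\<le>d. if i = j then E j v else 0)"
    by (intro sum.cong) auto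
  then show "E i v = v"
    using assms by (simp add: sum_E)
qed

text \<open>If \<open>v\<close> is an eigenvector for \<open>\<theta> i\<close>, comparing
  \<open>E j (A v)\<close> with \<open>E_A\<close> shows that \<open>\<theta> j\<close> and
  \<open>\<theta> i\<close> scale \<open>E j v\<close> alike, so injectivity of
  \<open>\<theta>\<close> kills every component with \<open>j \<noteq> i\<close>.\<close>

lemma eigen_iff:
  assumes "i \<le> d" "v \<in> V"
  shows "A v = s (\<theta> i) v \<longleftrightarrow> E i v = v"
proof
  assume *: "A v = s (\<theta> i) v"
  have "E j v = 0" if "j \<le> d" "j \<noteq> i" for j
  proof -
    have "s (\<theta> j) (E j v) = s (\<theta> i) (E j v)"
      using E_A[OF that(1) assms(2)] E_linear(2)[OF that(1) assms(2), of "\<theta> i"] * by metis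
    then show ?thesis
      using inj_onD[OF inj_theta, of i j] that assms by (metis atMost_iff scale_cancel_right)
  qed
  then show "E i v = v"
    using assms E_fixes_iff by blast
next
  assume "E i v = v"
  then show "A v = s (\<theta> i) v"
    using A_E assms by metis
qed

lemma image_E: "i \<le> d \<Longrightarrow> E i ` V = {v \<in> V. E i v = v}"
  using E_E E_in by (force simp: image_iff)

lemma image_E_eigenspace: "i \<le> d \<Longrightarrow> E i ` V = {v \<in> V. A v = s (\<theta> i) v}"
  using image_E eigen_iff by auto

lemma subspace_image_E: "i \<le> d \<Longrightarrow> subspace (E i ` V)"
  using subspace_eigenvectors[OF A_End] image_E_eigenspace by simp

lemma eigenspaces_eq: "eigenspaces s V A = (\<lambda>i. E i ` V) ` {0..d}"
proof
  show "(\<lambda>i. E i ` V) ` {0..d} \<subseteq> eigenspaces s V A"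
    using image_E_eigenspace E_nonzero by (fastforce simp: eigenspaces_def)
next
  show "eigenspaces s V A \<subseteq> (\<lambda>i. E i ` V) ` {0..d}"
  proof
    fix W assume "W \<in> eigenspaces s V A"
    then obtain t where W: "W = {v \<in> V. A v = s t v}" "W \<noteq> {0}"
      by (auto simp: eigenspaces_def)
    then obtain v where v: "v \<in> V" "A v = s t v" "v \<noteq> 0"
      using A_linear by fastforce
    \<comment> \<open>A nonzero eigenvector has a nonzero component, and this component forces the
      eigenvalue to be \<open>\<theta> i\<close>.\<close>
    then obtain i where i: "i \<le> d" "E i v \<noteq> 0"
      using sum_E[of v] by (metis atMost_iff sum.neutral)
    have "s (\<theta> i) (E i v) = s t (E i v)"
      using E_A[of i v] E_linear(2)[of i v t] i v by simp
    then have "t = \<theta> i"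
      using i by simp
    then show "W \<in> (\<lambda>i. E i ` V) ` {0..d}"
      using W i image_E_eigenspace by auto
  qed
qed

lemma image_E_inj:
  assumes "i \<le> d" "j \<le> d" "E i ` V = E j ` V"
  shows "i = j"
proof (rule ccontr)
  assume "i \<noteq> j"
  obtain v where "v \<in> V" "E i v \<noteq> 0"
    using E_nonzero assms by blast
  moreover have "E i v \<in> E j ` V"
    using \<open>v \<in> V\<close> assms(3) by blast
  ultimately show False
    using E_E[of i j] E_E[of i i] \<open>i \<noteq> j\<close> assms by fastforce
qed

lemma bij_betw_eigenspaces: "bij_betw (\<lambda>i. E i ` V) {0..d} (eigenspaces s V A)"
  using image_E_inj by (auto simp: bij_betw_def inj_on_def eigenspaces_eq)

lemma diagonalizable: "diagonalizable s V A"
proof -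
  have "span (\<Union>(eigenspaces s V A)) \<subseteq> V"
    using E_in by (intro span_minimal subspace_V) (auto simp: eigenspaces_eq)
  moreover have "v \<in> span (\<Union>(eigenspaces s V A))" if "v \<in> V" for v
  proof -
    have "(\<Sum>i\<le>d. E i v) \<in> span (\<Union>(eigenspaces s V A))"
      using that by (intro span_sum span_base) (auto simp: eigenspaces_eq)
    then show ?thesis
      by (simp add: sum_E that)
  qed
  ultimately show ?thesis
    unfolding diagonalizable_def by blast
qed

text \<open>A primitive idempotent is determined by the eigenspace it fixes: it kills the other
  eigenspaces, and every vector is a sum of eigenvectors.\<close>

lemma bij_betw_idempotents: "bij_betw E {0..d} (primitive_idempotents s V A)"
proof -
  have inj: "inj_on E {0..d}"
    using image_E_inj by (intro inj_onI) auto
  have "E i \<in> primitive_idempotents s V A" if "i \<le> d" for i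
  proof -
    have "\<forall>v\<in>E i ` V. E i v = v"
      using that by (auto simp: E_E)
    moreover have "\<forall>W'\<in>eigenspaces s V A - {E i ` V}. \<forall>v\<in>W'. E i v = 0"
      using that by (auto simp: eigenspaces_eq E_E split: if_splits)
    moreover have "E i ` V \<in> eigenspaces s V A"
      using that by (simp add: eigenspaces_eq)
    ultimately show ?thesis
      unfolding primitive_idempotents_def using E_End[OF that]
      by (intro CollectI conjI bexI[of _ "E i ` V"])
  qed
  moreover have "F \<in> E ` {0..d}" if F: "F \<in> primitive_idempotents s V A" for F
  proof -
    obtain W where W: "W \<in> eigenspaces s V A" "\<forall>v\<in>W. F v = v"
      "\<forall>W'\<in>eigenspaces s V A - {W}. \<forall>v\<in>W'. F v = 0"
      using F unfolding primitive_idempotents_def by blast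
    then obtain i where i: "i \<le> d" and WE: "W = E i ` V"
      by (auto simp: eigenspaces_eq)
    have FE: "F \<in> End_on s V"
      using F by (simp add: primitive_idempotents_def)
    have "F v = E i v" if v: "v \<in> V" for v
    proof -
      have "F (E j v) = (if i = j then E j v else 0)" if j: "j \<le> d" for j
      proof (cases "i = j")
        case True
        then show ?thesis
          using W(2) v by (simp add: WE)
      next
        case False
        then have "E j ` V \<in> eigenspaces s V A - {W}"
          using image_E_inj[OF j i] j by (auto simp: WE eigenspaces_eq)
        from bspec[OF bspec[OF W(3) this], of "E j v"] show ?thesis
          using False v by simp
      qed
      then have "(\<Sum>j\<le>d. F (E j v)) = E i v"
        using i by simp
      moreover have "(\<Sum>j\<le>d. F (E j v)) = F (\<Sum>j\<le>d. E j v)"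
        using v by (subst End_on_sum[OF FE]) (auto simp: E_in)
      ultimately show ?thesis
        by (simp add: sum_E v)
    qed
    then have "F = E i"
      using FE E_End[OF i] by (intro extensionalityI[where A = V]) (auto simp: End_on_def PiE_def)
    then show ?thesis
      using i by simp
  qed
  ultimately show ?thesis
    using inj by (auto simp: bij_betw_def)
qed

lemma eigenvalue_on_image_E:
  assumes "i \<le> d"
  shows "eigenvalue_on s (E i ` V) A = \<theta> i"
  unfolding eigenvalue_on_def
proof (rule the_equality)
  show "\<forall>w\<in>E i ` V. A w = s (\<theta> i) w"
    using A_E assms by auto
  obtain v where v: "v \<in> V" "E i v \<noteq> 0"
    using E_nonzero assms by blast
  show "t = \<theta> i" if "\<forall>w\<in>E i ` V. A w = s t w" for t
  proof -
    have "s t (E i v) = s (\<theta> i) (E i v)"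
      using that A_E[OF assms v(1)] v(1) by (metis imageI)
    then show ?thesis
      using v by simp
  qed
qed

text \<open>Containment in a span becomes the vanishing of the product of \<open>E j\<close>,
  \<open>B\<close> and \<open>E i\<close> whenever the indices differ by more than one. This form is
  symmetric in \<open>i\<close> and \<open>j\<close>, hence stable under the reversal of products
  that transposition causes.\<close>

lemma standard_ordering_iff:
  assumes "B \<in> End_on s V"
  shows "standard_ordering s V A B d (\<lambda>i. E i ` V) \<longleftrightarrow>
    (\<forall>i\<le>d. \<forall>j\<le>d. \<forall>v\<in>V. i + 1 < j \<or> j + 1 < i \<longrightarrow> E j (B (E i v)) = 0)"
    (is "_ \<longleftrightarrow> ?R")
proof -
  let ?N = "\<lambda>i. {j. j \<le> d \<and> i \<le> j + 1 \<and> j \<le> i + 1}"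
  have "B ` E i ` V \<subseteq> span (\<Union>j\<in>?N i. E j ` V) \<longleftrightarrow>
      (\<forall>j\<le>d. \<forall>v\<in>V. i + 1 < j \<or> j + 1 < i \<longrightarrow> E j (B (E i v)) = 0)" (is "?l \<longleftrightarrow> ?r")
    if i: "i \<le> d" for i
  proof
    assume ?l
    have "E j (B (E i v)) = 0" if j: "j \<le> d" "i + 1 < j \<or> j + 1 < i" and v: "v \<in> V" for j v
    proof -
      have "subspace {u \<in> V. E j u = s 0 u}"
        using E_End j by (intro subspace_eigenvectors)
      moreover have "(\<Union>j\<in>?N i. E j ` V) \<subseteq> {u \<in> V. E j u = s 0 u}"
        using j by (auto simp: E_in E_E)
      ultimately have "span (\<Union>j\<in>?N i. E j ` V) \<subseteq> {u \<in> V. E j u = s 0 u}"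
        by (rule span_minimal[rotated])
      then show ?thesis
        using \<open>?l\<close> v by auto
    qed
    then show ?r
      by blast
  next
    assume r: ?r
    have "B (E i v) \<in> span (\<Union>j\<in>?N i. E j ` V)" if v: "v \<in> V" for v
    proof -
      have w: "B (E i v) \<in> V"
        using assms E_in i v End_on_in by blast
      have "E j (B (E i v)) \<in> span (\<Union>j\<in>?N i. E j ` V)" if "j \<le> d" for j
      proof (cases "j \<in> ?N i")
        case True
        then show ?thesis
          using w by (intro span_base) blast
      next
        case False
        then have "E j (B (E i v)) = 0"
          using r that v by auto
        then show ?thesis
          by (simp add: span_zero)
      qed
      then have "(\<Sum>j\<le>d. E j (B (E i v))) \<in> span (\<Union>j\<in>?N i. E j ` V)"
        by (intro span_sum) auto
      then show ?thesis
        by (simp add: sum_E w)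
    qed
    then show ?l
      by blast
  qed
  then show ?thesis
    by (simp add: standard_ordering_def bij_betw_eigenspaces)
qed

end

text \<open>The definition of a primitive idempotent only provides some eigenspace that it fixes.
  Once this is identified with its image, injectivity of the indexing by images gives orthogonality,
  and the sum formula extends from eigenvectors by linearity.\<close>

lemma (in carrier_space) spectral_resolution_exists:
  assumes A: "A \<in> End_on s V" and dg: "diagonalizable s V A"
    and idem: "bij_betw E {0..d} (primitive_idempotents s V A)"
    and eig: "bij_betw (\<lambda>i. E i ` V) {0..d} (eigenspaces s V A)"
  shows "\<exists>\<theta>. spectral_resolution s V d A E \<theta>"
proof -
  have EP: "E i \<in> primitive_idempotents s V A" if "i \<le> d" for i
    using that idem by (auto simp: bij_betw_def)
  then have EE: "E i \<in> End_on s V" if "i \<le> d" for i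
    using that by (auto simp: primitive_idempotents_def)
  have V: "span (\<Union>(eigenspaces s V A)) = V"
    using dg by (simp add: diagonalizable_def)
  have image: "(\<forall>v\<in>E i ` V. E i v = v) \<and> (\<forall>W'\<in>eigenspaces s V A - {E i ` V}. \<forall>v\<in>W'. E i v = 0)"
    if i: "i \<le> d" for i
  proof -
    obtain W where W: "W \<in> eigenspaces s V A" "\<forall>v\<in>W. E i v = v"
      "\<forall>W'\<in>eigenspaces s V A - {W}. \<forall>v\<in>W'. E i v = 0"
      using EP[OF i] by (auto simp: primitive_idempotents_def)
    obtain t where t: "W = {v \<in> V. A v = s t v}"
      using W by (auto simp: eigenspaces_def)
    have sW: "subspace W"
      unfolding t by (rule subspace_eigenvectors[OF A])
    \<comment> \<open>The vectors sent into \<open>W\<close> by \<open>E i\<close> form a subspace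
      that contains every eigenspace, so \<open>E i\<close> maps all of \<open>V\<close> into
      \<open>W\<close>.\<close>
    have "subspace {v \<in> V. E i v \<in> W}"
      using sW EE[OF i]
      by (intro subspaceI)
        (auto simp: End_on_zero End_on_add End_on_scale V_closed subspace_0 intro: subspace_add subspace_scale)
    moreover have "\<Union>(eigenspaces s V A) \<subseteq> {v \<in> V. E i v \<in> W}"
    proof
      fix v assume "v \<in> \<Union>(eigenspaces s V A)"
      then obtain W' where W': "W' \<in> eigenspaces s V A" "v \<in> W'"
        by blast
      then have "v \<in> V"
        by (auto simp: eigenspaces_def)
      moreover have "E i v \<in> W"
        using W W' sW by (cases "W' = W") (auto simp: subspace_0)
      ultimately show "v \<in> {v \<in> V. E i v \<in> W}"
        by simp
    qed
    ultimately have "V \<subseteq> {v \<in> V. E i v \<in> W}"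
      using span_minimal V by metis
    moreover have "W \<subseteq> E i ` V"
      using W(2) t by force
    ultimately have "E i ` V = W"
      by blast
    then show ?thesis
      using W by simp
  qed
  have mem: "E i ` V \<in> eigenspaces s V A" if "i \<le> d" for i
    using bij_betwE[OF eig] that by simp
  have orth: "E i (E j v) = (if i = j then E j v else 0)" if "i \<le> d" "j \<le> d" "v \<in> V" for i j v
  proof (cases "i = j")
    case True
    then show ?thesis
      using conjunct1[OF image[OF that(1)]] that(3) by simp
  next
    case False
    have "E j ` V \<in> eigenspaces s V A"
      by (rule mem[OF that(2)])
    moreover have "E j ` V \<noteq> E i ` V"
      using False that inj_onD[OF bij_betw_imp_inj_on[OF eig], of i j] by auto
    ultimately have "E j ` V \<in> eigenspaces s V A - {E i ` V}"
      by simp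
    from bspec[OF bspec[OF conjunct2[OF image[OF that(1)]] this], of "E j v"]
    have "E i (E j v) = 0"
      using that(3) by simp
    then show ?thesis
      using False by simp
  qed
  have "\<exists>t. E i ` V = {v \<in> V. A v = s t v} \<and> E i ` V \<noteq> {0}" if "i \<le> d" for i
    using mem[OF that] unfolding eigenspaces_def by blast
  then obtain \<theta> where th: "E i ` V = {v \<in> V. A v = s (\<theta> i) v}" "E i ` V \<noteq> {0}" if "i \<le> d" for i
    by metis
  have "spectral_resolution s V d A E \<theta>"
  proof
    show "inj_on \<theta> {..d}"
      using th(1) inj_onD[OF bij_betw_imp_inj_on[OF eig]] by (intro inj_onI) auto
    show "\<exists>v\<in>V. E i v \<noteq> 0" if "i \<le> d" for i
    proof -
      have "0 \<in> E i ` V"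
        using End_on_zero[OF EE[OF that]] V_zero by (metis imageI)
      then show ?thesis
        using th(2)[OF that] by auto
    qed
    show "A (E i v) = s (\<theta> i) (E i v)" if "i \<le> d" "v \<in> V" for i v
      using th(1)[OF that(1)] that by blast
    show "(\<Sum>i\<le>d. E i v) = v" if "v \<in> V" for v
    proof -
      have "subspace {v \<in> V. (\<Sum>i\<le>d. E i v) = v}"
        using EE by (intro subspaceI)
          (auto simp: End_on_zero End_on_add End_on_scale V_closed sum.distrib
            simp flip: scale_sum_right)
      moreover have "\<Union>(eigenspaces s V A) \<subseteq> {v \<in> V. (\<Sum>i\<le>d. E i v) = v}"
      proof
        fix v assume "v \<in> \<Union>(eigenspaces s V A)"
        then obtain j w where j: "j \<le> d" "w \<in> V" "v = E j w"
          unfolding bij_betw_imp_surj_on[OF eig, symmetric] by auto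
        then have "(\<Sum>i\<le>d. E i v) = (\<Sum>i\<le>d. if i = j then v else 0)"
          by (intro sum.cong) (auto simp: orth)
        then show "v \<in> {v \<in> V. (\<Sum>i\<le>d. E i v) = v}"
          using j EE End_on_in by auto
      qed
      ultimately show ?thesis
        using span_minimal V that by blast
    qed
  qed (use A EE orth in auto)
  then show ?thesis
    by (intro exI)
qed

section \<open>Tridiagonal systems\<close>

text \<open>Among the components \<open>E l w\<close>, tridiagonality lets only those with
  \<open>l\<close> at distance at most one from \<open>k\<close> contribute to
  \<open>E k (B w)\<close>.\<close>

lemma (in spectral_resolution) E_tridiagonal_vanish:
  assumes B: "B \<in> End_on s V"
    and tri: "\<And>i j v. i \<le> d \<Longrightarrow> j \<le> d \<Longrightarrow> v \<in> V \<Longrightarrow> i + 1 < j \<or> j + 1 < i \<Longrightarrow> E j (B (E i v)) = 0"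
    and k: "k \<le> d" and w: "w \<in> V"
    and zero: "\<And>l. l \<le> d \<Longrightarrow> k \<le> l + 1 \<Longrightarrow> l \<le> k + 1 \<Longrightarrow> E l w = 0"
  shows "E k (B w) = 0"
proof -
  have "E k (B w) = E k (B (\<Sum>l\<le>d. E l w))"
    by (simp add: sum_E w)
  also have "\<dots> = E k (\<Sum>l\<le>d. B (E l w))"
    using w by (subst End_on_sum[OF B]) (auto simp: E_in)
  also have "\<dots> = (\<Sum>l\<le>d. E k (B (E l w)))"
    using w k by (subst End_on_sum[OF E_End]) (auto simp: E_in End_on_in[OF B])
  also have "\<dots> = 0"
  proof (intro sum.neutral ballI)
    fix l assume "l \<in> {..d}"
    then show "E k (B (E l w)) = 0"
      using tri[of l k w] zero[of l] k w
      by (cases "l + 1 < k \<or> k + 1 < l") (auto simp: End_on_zero[OF B] E_linear)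
  qed
  finally show ?thesis .
qed

text \<open>A tridiagonal system in equational form. The eigenvalues are parameters instead of being
  extracted by \<open>eigenvalue_on\<close>; \<open>theta_eq\<close> and \<open>theta_s_eq\<close>
  restore the link.\<close>

locale td_resolution =
  R: spectral_resolution s V "diam \<Phi>" "opA \<Phi>" "idE \<Phi>" \<theta> +
  S: spectral_resolution s V "diam \<Phi>" "opAs \<Phi>" "idEs \<Phi>" \<theta>'
  for s :: "'k::field \<Rightarrow> 'v::ab_group_add \<Rightarrow> 'v" and V and \<Phi> :: "'v td_data" and \<theta> \<theta>' +
  assumes tri: "i \<le> diam \<Phi> \<Longrightarrow> j \<le> diam \<Phi> \<Longrightarrow> v \<in> V \<Longrightarrow> i + 1 < j \<or> j + 1 < i \<Longrightarrow>
      idE \<Phi> j (opAs \<Phi> (idE \<Phi> i v)) = 0"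
    and tri_s: "i \<le> diam \<Phi> \<Longrightarrow> j \<le> diam \<Phi> \<Longrightarrow> v \<in> V \<Longrightarrow> i + 1 < j \<or> j + 1 < i \<Longrightarrow>
      idEs \<Phi> j (opA \<Phi> (idEs \<Phi> i v)) = 0"
    and irreducible: "R.subspace W \<Longrightarrow> W \<subseteq> V \<Longrightarrow> opA \<Phi> ` W \<subseteq> W \<Longrightarrow> opAs \<Phi> ` W \<subseteq> W \<Longrightarrow>
      W = {0} \<or> W = V"

lemma td_system_imp_resolution:
  assumes "carrier_space s V" "td_system s V \<Phi>"
  shows "\<exists>\<theta> \<theta>'. td_resolution s V \<Phi> \<theta> \<theta>'"
proof -
  interpret carrier_space s V by fact
  have pair: "tridiagonal_pair s V (opA \<Phi>) (opAs \<Phi>)"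
    and E: "bij_betw (idE \<Phi>) {0..diam \<Phi>} (primitive_idempotents s V (opA \<Phi>))"
    and Es: "bij_betw (idEs \<Phi>) {0..diam \<Phi>} (primitive_idempotents s V (opAs \<Phi>))"
    and so: "standard_ordering s V (opA \<Phi>) (opAs \<Phi>) (diam \<Phi>) (\<lambda>i. idE \<Phi> i ` V)"
      "standard_ordering s V (opAs \<Phi>) (opA \<Phi>) (diam \<Phi>) (\<lambda>i. idEs \<Phi> i ` V)"
    using assms(2) by (simp_all add: td_system_def)
  have A: "opA \<Phi> \<in> End_on s V" "opAs \<Phi> \<in> End_on s V"
    and dg: "diagonalizable s V (opA \<Phi>)" "diagonalizable s V (opAs \<Phi>)"
    and irred: "\<not> (\<exists>W. subspace W \<and> W \<subseteq> V \<and> W \<noteq> {0} \<and> W \<noteq> V \<and> opA \<Phi> ` W \<subseteq> W \<and> opAs \<Phi> ` W \<subseteq> W)"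
    using pair by (simp_all add: tridiagonal_pair_def)
  have bij: "bij_betw (\<lambda>i. idE \<Phi> i ` V) {0..diam \<Phi>} (eigenspaces s V (opA \<Phi>))"
    "bij_betw (\<lambda>i. idEs \<Phi> i ` V) {0..diam \<Phi>} (eigenspaces s V (opAs \<Phi>))"
    using so by (simp_all only: standard_ordering_def)
  from spectral_resolution_exists[OF A(1) dg(1) E bij(1)]
  obtain \<theta> where R: "spectral_resolution s V (diam \<Phi>) (opA \<Phi>) (idE \<Phi>) \<theta>"
    by (rule exE)
  from spectral_resolution_exists[OF A(2) dg(2) Es bij(2)]
  obtain \<theta>' where S: "spectral_resolution s V (diam \<Phi>) (opAs \<Phi>) (idEs \<Phi>) \<theta>'"
    by (rule exE)
  have tri: "\<forall>i\<le>diam \<Phi>. \<forall>j\<le>diam \<Phi>. \<forall>v\<in>V. i + 1 < j \<or> j + 1 < i \<longrightarrow>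
      idE \<Phi> j (opAs \<Phi> (idE \<Phi> i v)) = 0"
    using so(1) unfolding spectral_resolution.standard_ordering_iff[OF R A(2)] .
  have tri_s: "\<forall>i\<le>diam \<Phi>. \<forall>j\<le>diam \<Phi>. \<forall>v\<in>V. i + 1 < j \<or> j + 1 < i \<longrightarrow>
      idEs \<Phi> j (opA \<Phi> (idEs \<Phi> i v)) = 0"
    using so(2) unfolding spectral_resolution.standard_ordering_iff[OF S A(1)] .
  have "td_resolution_axioms s V \<Phi>"
  proof (rule td_resolution_axioms.intro)
    show "idE \<Phi> j (opAs \<Phi> (idE \<Phi> i v)) = 0"
      if "i \<le> diam \<Phi>" "j \<le> diam \<Phi>" "v \<in> V" "i + 1 < j \<or> j + 1 < i" for i j v
      by (rule tri[rule_format, OF that])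
    show "idEs \<Phi> j (opA \<Phi> (idEs \<Phi> i v)) = 0"
      if "i \<le> diam \<Phi>" "j \<le> diam \<Phi>" "v \<in> V" "i + 1 < j \<or> j + 1 < i" for i j v
      by (rule tri_s[rule_format, OF that])
    show "W = {0} \<or> W = V"
      if "subspace W" "W \<subseteq> V" "opA \<Phi> ` W \<subseteq> W" "opAs \<Phi> ` W \<subseteq> W" for W
      using irred that by metis
  qed
  with R S have "td_resolution s V \<Phi> \<theta> \<theta>'"
    by (rule td_resolution.intro)
  then show ?thesis
    by (intro exI)
qed

section \<open>Consequences of irreducibility for the first eigenspaces\<close>

context td_resolution
begin

abbreviation "d \<equiv> diam \<Phi>"
abbreviation "A \<equiv> opA \<Phi>"
abbreviation "As \<equiv> opAs \<Phi>"
abbreviation "E \<equiv> idE \<Phi>"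
abbreviation "Es \<equiv> idEs \<Phi>"

text \<open>Converse of \<open>td_system_imp_resolution\<close>, for use after transposition, where
  the equational form is what is established.\<close>

lemma td_system: "td_system s V \<Phi>"
proof -
  have so: "standard_ordering s V A As d (\<lambda>i. E i ` V)" "standard_ordering s V As A d (\<lambda>i. Es i ` V)"
    unfolding R.standard_ordering_iff[OF S.A_End] S.standard_ordering_iff[OF R.A_End]
    by (intro allI ballI impI tri tri_s; assumption)+
  moreover have "tridiagonal_pair s V A As"
    unfolding tridiagonal_pair_def
    using R.A_End S.A_End R.diagonalizable S.diagonalizable so irreducible by blast
  ultimately show ?thesis
    using R.bij_betw_idempotents S.bij_betw_idempotents by (simp add: td_system_def)
qed

lemma theta_eq: "i \<le> d \<Longrightarrow> theta s V \<Phi> i = \<theta> i"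
  and theta_s_eq: "i \<le> d \<Longrightarrow> theta_s s V \<Phi> i = \<theta>' i"
  by (simp_all add: theta_def theta_s_def R.eigenvalue_on_image_E S.eigenvalue_on_image_E)

lemmas E_vanish = R.E_tridiagonal_vanish[OF S.A_End tri]
lemmas Es_vanish = S.E_tridiagonal_vanish[OF R.A_End tri_s]

text \<open>
  The sum over \<open>i\<close> of the spaces \<open>(E\<^sup>*\<^sub>0V + \<dots> + E\<^sup>*\<^sub>iV) \<inter> (E\<^sub>i\<^sub>+\<^sub>1V + \<dots> + E\<^sub>dV)\<close> is invariant under both
  operators and lies in the kernel of \<open>E\<^sub>0\<close>, so it is zero; the case \<open>i = 0\<close> is the claim.
\<close>

lemma Es0_E0_kernel:
  assumes v: "v \<in> V" "Es 0 v = v" "E 0 v = 0"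
  shows "v = 0"
proof -
  \<comment> \<open>Both sums of eigenspaces are expressed by vanishing components, and
    \<open>i\<close> runs over all naturals: for \<open>d \<le> i\<close> all components under
    \<open>E\<close> vanish, so \<open>U i\<close> is zero.\<close>
  define U where "U i = {v \<in> V. (\<forall>k\<le>d. i < k \<longrightarrow> Es k v = 0) \<and> (\<forall>k\<le>d. k \<le> i \<longrightarrow> E k v = 0)}" for i
  define W where "W = R.span (\<Union>i. U i)"
  have U_triv: "u = 0" if "u \<in> U i" "d \<le> i" for u i
  proof -
    have "(\<Sum>k\<le>d. E k u) = 0"
      using that by (intro sum.neutral) (auto simp: U_def)
    then show ?thesis
      using R.sum_E[of u] that by (simp add: U_def)
  qed
  have UW: "u \<in> W" if "u \<in> U i" for u i
    using that unfolding W_def by (intro R.span_base) blast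
  have sub: "R.subspace W"
    by (simp add: W_def)
  have W_in: "W \<subseteq> {v \<in> V. E 0 v = s 0 v}"
    unfolding W_def
    by (rule R.span_minimal[OF _ R.subspace_eigenvectors[OF R.E_End]]) (auto simp: U_def)
  then have WV: "W \<subseteq> V"
    by blast
  have A_U: "A u \<in> W" if u: "u \<in> U i" for u i
  proof (cases "d \<le> i")
    case True
    then show ?thesis
      using U_triv[OF u] sub by (simp add: R.A_linear R.subspace_0)
  next
    case False
    have uV: "u \<in> V"
      using u by (simp add: U_def)
    \<comment> \<open>The shift by \<open>\<theta> (Suc i)\<close> removes the one further
      \<open>E\<close> component that must vanish in \<open>U (Suc i)\<close>, while
      \<open>A\<close> raises the top \<open>Es\<close> index by at most one.\<close>
    have "A u - s (\<theta> (Suc i)) u \<in> U (Suc i)"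
      unfolding U_def
    proof (intro CollectI conjI allI impI)
      show "A u - s (\<theta> (Suc i)) u \<in> V"
        using uV by (simp add: R.V_closed R.A_in)
      show "Es k (A u - s (\<theta> (Suc i)) u) = 0" if k: "k \<le> d" "Suc i < k" for k
      proof -
        have "Es k (A u) = 0"
          using u k by (intro Es_vanish) (auto simp: U_def)
        moreover have "Es k u = 0"
          using u k by (simp add: U_def)
        ultimately show ?thesis
          using uV k by (simp add: S.E_linear R.A_in R.V_scale)
      qed
      show "E k (A u - s (\<theta> (Suc i)) u) = 0" if k: "k \<le> d" "k \<le> Suc i" for k
        using u uV k
        by (cases "k = Suc i") (auto simp: U_def R.E_linear R.A_in R.V_scale R.E_A)
    qed
    then have "A u - s (\<theta> (Suc i)) u + s (\<theta> (Suc i)) u \<in> W"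
      using sub UW u by (blast intro: R.subspace_add R.subspace_scale)
    then show ?thesis
      by simp
  qed
  have As_U: "As u \<in> W" if u: "u \<in> U i" for u i
  proof (cases i)
    case 0
    have uV: "u \<in> V"
      using u by (simp add: U_def)
    then have "Es 0 u = u"
      using u 0 by (subst S.E_fixes_iff) (auto simp: U_def)
    then have "As u = s (\<theta>' 0) u"
      using S.eigen_iff uV by blast
    then show ?thesis
      using sub UW u by (simp add: R.subspace_scale)
  next
    case (Suc j)
    have uV: "u \<in> V"
      using u by (simp add: U_def)
    \<comment> \<open>Dually, the shift removes the top component, that under \<open>Es i\<close>,
      while \<open>As\<close> lowers the least \<open>E\<close> index by at most one.\<close>
    have "As u - s (\<theta>' i) u \<in> U j"
      unfolding U_def
    proof (intro CollectI conjI allI impI)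
      show "As u - s (\<theta>' i) u \<in> V"
        using uV by (simp add: R.V_closed S.A_in)
      show "E k (As u - s (\<theta>' i) u) = 0" if k: "k \<le> d" "k \<le> j" for k
      proof -
        have "E k (As u) = 0"
          using u k Suc by (intro E_vanish) (auto simp: U_def)
        moreover have "E k u = 0"
          using u k Suc by (simp add: U_def)
        ultimately show ?thesis
          using uV k by (simp add: R.E_linear S.A_in R.V_scale)
      qed
      show "Es k (As u - s (\<theta>' i) u) = 0" if k: "k \<le> d" "j < k" for k
        using u uV k Suc
        by (cases "k = i") (auto simp: U_def S.E_linear S.A_in R.V_scale S.E_A)
    qed
    then have "As u - s (\<theta>' i) u + s (\<theta>' i) u \<in> W"
      using sub UW u by (blast intro: R.subspace_add R.subspace_scale)
    then show ?thesis
      by simp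
  qed
  have inv: "B ` W \<subseteq> W" if B: "B \<in> End_on s V" "\<And>u i. u \<in> U i \<Longrightarrow> B u \<in> W" for B
  proof -
    have "R.subspace {u \<in> V. B u \<in> W}"
      using sub B(1) by (intro R.subspaceI)
        (auto simp: R.End_on_zero R.End_on_add R.End_on_scale R.V_closed R.subspace_0
          intro: R.subspace_add R.subspace_scale)
    moreover have "(\<Union>i. U i) \<subseteq> {u \<in> V. B u \<in> W}"
      using B(2) by (auto simp: U_def)
    ultimately show ?thesis
      using R.span_minimal unfolding W_def by blast
  qed
  have "W \<noteq> V"
    using W_in R.E_nonzero[of 0] by auto
  moreover have "A ` W \<subseteq> W"
    using R.A_End A_U by (rule inv)
  moreover have "As ` W \<subseteq> W"
    using S.A_End As_U by (rule inv)
  ultimately have "W = {0}"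
    using irreducible[OF sub WV] by blast
  moreover have "v \<in> U 0"
    using v S.E_fixes_iff[of 0 v] by (auto simp: U_def)
  ultimately show ?thesis
    using UW by blast
qed

text \<open>By \<open>Es0_E0_kernel\<close> the map \<open>E 0\<close> is injective on the image of
  \<open>Es 0\<close>, so this nonzero space embeds into the line that is the image of
  \<open>E 0\<close>.\<close>

lemma image_Es0:
  assumes "R.dim (E 0 ` V) = 1"
  obtains e where "e \<in> V" "e \<noteq> 0" "Es 0 ` V = range (\<lambda>c. s c e)"
proof -
  obtain g where g: "E 0 ` V = range (\<lambda>c. s c g)"
    using R.dim_eq_1_obtain[OF R.subspace_image_E assms] by blast
  obtain x where x: "x \<in> V" "Es 0 x \<noteq> 0"
    using S.E_nonzero by blast
  define e where "e = Es 0 x"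
  have e: "e \<in> V" "Es 0 e = e" "e \<noteq> 0"
    using x by (auto simp: e_def S.E_in S.E_E)
  have E0e: "E 0 e \<noteq> 0"
    using Es0_E0_kernel e by blast
  have "Es 0 v \<in> range (\<lambda>c. s c e)" if v: "v \<in> V" for v
  proof -
    have "E 0 e \<in> range (\<lambda>c. s c g)" "E 0 (Es 0 v) \<in> range (\<lambda>c. s c g)"
      using e(1) S.E_in[OF _ v, of 0] unfolding g[symmetric] by simp_all
    then obtain a b where a: "E 0 e = s a g" and b: "E 0 (Es 0 v) = s b g"
      by (elim rangeE)
    have "a \<noteq> 0"
      using a E0e by auto
    \<comment> \<open>The coefficient \<open>b / a\<close> is the one for which \<open>E 0 u\<close>
      vanishes.\<close>
    define u where "u = Es 0 v - s (b / a) e"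
    have "E 0 u = 0"
      using a b \<open>a \<noteq> 0\<close> e v by (simp add: u_def R.E_linear S.E_in R.V_scale)
    moreover have "Es 0 u = u" "u \<in> V"
      using e v by (simp_all add: u_def S.E_linear S.E_E S.E_in R.V_closed)
    ultimately have "Es 0 v = s (b / a) e"
      using Es0_E0_kernel[of u] by (simp add: u_def)
    then show ?thesis
      by blast
  qed
  moreover have "s c e \<in> Es 0 ` V" for c
    using S.E_linear(2)[of 0 e c] e by (intro rev_image_eqI[of "s c e"]) (simp_all add: R.V_scale)
  ultimately show thesis
    using that e by blast
qed

end

section \<open>The split sequence\<close>

text \<open>Both operator products in \<open>split_operator\<close> have this shape. The scalars are
  a parameter so that \<open>theta\<close> and \<open>theta_s\<close> can be exchanged for the
  eigenvalues of the locale.\<close>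

definition shift_prod :: "('k::field \<Rightarrow> 'v::ab_group_add \<Rightarrow> 'v) \<Rightarrow> ('v \<Rightarrow> 'v) \<Rightarrow> (nat \<Rightarrow> 'k) \<Rightarrow> nat list \<Rightarrow> 'v \<Rightarrow> 'v" where
  "shift_prod s f c xs = foldr (\<lambda>j u. f u - s (c j) u) xs"

lemma shift_prod_simps [simp]:
  "shift_prod s f c [] v = v"
  "shift_prod s f c (j # xs) v = f (shift_prod s f c xs v) - s (c j) (shift_prod s f c xs v)"
  by (simp_all add: shift_prod_def)

lemma shift_prod_cong:
  "(\<And>j. j \<in> set xs \<Longrightarrow> c j = c' j) \<Longrightarrow> shift_prod s f c xs v = shift_prod s f c' xs v"
  by (induction xs) auto

context carrier_space
begin

lemma shift_prod_in: "f \<in> End_on s V \<Longrightarrow> v \<in> V \<Longrightarrow> shift_prod s f c xs v \<in> V"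
  by (induction xs) (simp_all add: V_closed End_on_in)

lemma shift_prod_scale:
  assumes "f \<in> End_on s V" "v \<in> V"
  shows "shift_prod s f c xs (s t v) = s t (shift_prod s f c xs v)"
  using assms
  by (induction xs)
    (simp_all add: End_on_scale shift_prod_in scale_right_diff_distrib scale_left_commute)

text \<open>All factors are polynomials in \<open>f\<close> and commute, so a further factor may act
  first or last.\<close>

lemma shift_prod_commute:
  assumes "f \<in> End_on s V" "v \<in> V"
  shows "shift_prod s f c xs (f v - s t v) = f (shift_prod s f c xs v) - s t (shift_prod s f c xs v)"
  using assms
  by (induction xs)
    (simp_all add: End_on_diff End_on_scale End_on_in V_closed shift_prod_in scale_right_diff_distrib
      scale_left_commute)

end

text \<open>By \<open>E_A\<close>, each factor becomes a scalar when \<open>E i\<close> passes it.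
  In particular the result is zero as soon as some listed \<open>c j\<close> equals
  \<open>\<theta> i\<close>.\<close>

lemma (in spectral_resolution) E_shift_prod:
  assumes "i \<le> d" "v \<in> V"
  shows "E i (shift_prod s A c xs v) = s (\<Prod>j\<leftarrow>xs. \<theta> i - c j) (E i v)"
  using assms
  by (induction xs)
    (simp_all add: E_linear E_A V_closed A_in shift_prod_in[OF A_End] scale_left_diff_distrib
      flip: scale_scale)

context td_resolution
begin

text \<open>Each factor raises the largest index of a nonzero \<open>Es\<close> component by at most
  one, starting from index 0.\<close>

lemma Es_shift_prod_vanish:
  assumes "e \<in> V" "Es 0 e = e" "i < j" "j \<le> d"
  shows "Es j (shift_prod s A \<theta> (rev [0..<i]) e) = 0"
  using assms(3,4)
proof (induction i arbitrary: j)
  case 0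
  then show ?case
    using assms(1,2) S.E_fixes_iff[of 0 e] by simp
next
  case (Suc i)
  let ?w = "shift_prod s A \<theta> (rev [0..<i]) e"
  have w: "?w \<in> V"
    using assms(1) R.A_End by (simp add: R.shift_prod_in)
  have "Es j (A ?w) = 0"
    using Suc w by (intro Es_vanish) auto
  then show ?case
    using Suc w by (simp add: S.E_linear R.A_in R.V_scale)
qed

text \<open>The result lies in the image of \<open>Es 0\<close>: the factors in \<open>As\<close>
  kill the components 1 to \<open>i\<close>, and higher components are absent by
  \<open>Es_shift_prod_vanish\<close>. Applying \<open>Es 0\<close> thus changes nothing, yet it
  turns every factor in \<open>As\<close> into a scalar.\<close>

lemma split_operator_eq:
  assumes e: "e \<in> V" "Es 0 e = e" and i: "i \<le> d"
  shows "split_operator s V \<Phi> i e =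
    s (\<Prod>j\<leftarrow>[1..<Suc i]. \<theta>' 0 - \<theta>' j) (Es 0 (shift_prod s A \<theta> (rev [0..<i]) e))"
proof -
  let ?w = "shift_prod s A \<theta> (rev [0..<i]) e"
  let ?z = "shift_prod s As \<theta>' [1..<Suc i] ?w"
  have w: "?w \<in> V"
    using e R.A_End by (simp add: R.shift_prod_in)
  have z: "?z \<in> V"
    using w S.A_End by (rule R.shift_prod_in[rotated])
  have "Es k ?z = 0" if k: "k \<le> d" "k \<noteq> 0" for k
  proof (cases "k \<le> i")
    case True
    then have "k \<in> set [1..<Suc i]"
      using k by auto
    then have "(\<Prod>j\<leftarrow>[1..<Suc i]. \<theta>' k - \<theta>' j) = 0"
      unfolding prod_list_zero_iff set_map by (rule rev_image_eqI) simp
    then show ?thesis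
      by (subst S.E_shift_prod[OF k(1) w]) simp
  next
    case False
    then show ?thesis
      using Es_shift_prod_vanish[OF e, of i k] k by (subst S.E_shift_prod[OF k(1) w]) simp
  qed
  then have "Es 0 ?z = ?z"
    using z by (subst S.E_fixes_iff) auto
  moreover have "split_operator s V \<Phi> i e = ?z"
  proof -
    have "shift_prod s As (theta_s s V \<Phi>) [1..<Suc i] = shift_prod s As \<theta>' [1..<Suc i]"
      using i by (intro ext shift_prod_cong) (auto simp: theta_s_eq)
    moreover have "shift_prod s A (theta s V \<Phi>) (rev [0..<i]) = shift_prod s A \<theta> (rev [0..<i])"
      using i by (intro ext shift_prod_cong) (auto simp: theta_eq)
    ultimately show ?thesis
      unfolding split_operator_def shift_prod_def by metis
  qed
  moreover have "Es 0 ?z = s (\<Prod>j\<leftarrow>[1..<Suc i]. \<theta>' 0 - \<theta>' j) (Es 0 ?w)"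
    by (rule S.E_shift_prod[OF _ w]) simp
  ultimately show ?thesis
    by simp
qed

text \<open>For index 0 the second span in the intersection is all of \<open>V\<close>.\<close>

lemma split_component_0: "split_component s V \<Phi> 0 = Es 0 ` V"
proof -
  have "V \<subseteq> R.span (\<Union>j\<in>{0..d}. E j ` V)"
  proof
    fix v assume v: "v \<in> V"
    have "(\<Sum>j\<le>d. E j v) \<in> R.span (\<Union>j\<in>{0..d}. E j ` V)"
      using v by (intro R.span_sum R.span_base) auto
    then show "v \<in> R.span (\<Union>j\<in>{0..d}. E j ` V)"
      using v by (simp add: R.sum_E)
  qed
  moreover have "Es 0 ` V \<subseteq> V"
    using S.E_in by blast
  moreover have "R.span (\<Union>j\<in>{0..0}. Es j ` V) = Es 0 ` V"
    by (simp add: S.subspace_image_E)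
  ultimately show ?thesis
    unfolding split_component_def by blast
qed

text \<open>The image of \<open>Es 0\<close> is a line, so the right side is some
  \<open>s t e\<close>. The split operator acts as \<open>t\<close> on that whole line, and
  \<open>e \<noteq> 0\<close> makes \<open>t\<close> the only candidate in
  \<open>eigenvalue_on\<close>.\<close>

lemma zeta_eq:
  assumes e: "e \<in> V" "e \<noteq> 0" "Es 0 ` V = range (\<lambda>c. s c e)" and i: "i \<le> d"
  shows "s (zeta s V \<Phi> i) e =
    s (\<Prod>j\<leftarrow>[1..<Suc i]. \<theta>' 0 - \<theta>' j) (Es 0 (shift_prod s A \<theta> (rev [0..<i]) e))"
    (is "_ = ?r")
proof -
  have fix_e: "Es 0 (s c e) = s c e" for c
  proof -
    have "s c e \<in> Es 0 ` V"
      unfolding e(3) by (rule range_eqI) (rule refl)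
    then obtain v where "v \<in> V" "s c e = Es 0 v"
      by (elim imageE)
    then show ?thesis
      by (simp add: S.E_E)
  qed
  have Es0e: "Es 0 e = e"
    using fix_e[of 1] by simp
  have "?r \<in> range (\<lambda>c. s c e)"
  proof -
    have "Es 0 (shift_prod s A \<theta> (rev [0..<i]) e) \<in> range (\<lambda>c. s c e)"
      unfolding e(3)[symmetric] using R.shift_prod_in[OF R.A_End e(1)] by (rule imageI)
    then obtain b where "Es 0 (shift_prod s A \<theta> (rev [0..<i]) e) = s b e"
      by (elim rangeE)
    then show ?thesis
      by (intro range_eqI[of _ _ "(\<Prod>j\<leftarrow>[1..<Suc i]. \<theta>' 0 - \<theta>' j) * b"]) simp
  qed
  then obtain t where t: "?r = s t e"
    by (elim rangeE)
  have split: "split_operator s V \<Phi> i (s c e) = s c (s t e)" for c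
  proof -
    let ?p = "\<Prod>j\<leftarrow>[1..<Suc i]. \<theta>' 0 - \<theta>' j" and ?\<tau> = "shift_prod s A \<theta> (rev [0..<i])"
    have "split_operator s V \<Phi> i (s c e) = s ?p (Es 0 (?\<tau> (s c e)))"
      by (rule split_operator_eq[OF R.V_scale[OF e(1)] fix_e i])
    also have "Es 0 (?\<tau> (s c e)) = s c (Es 0 (?\<tau> e))"
      using e(1) by (simp add: R.shift_prod_scale[OF R.A_End] S.E_linear R.shift_prod_in[OF R.A_End])
    also have "s ?p (s c (Es 0 (?\<tau> e))) = s c (s ?p (Es 0 (?\<tau> e)))"
      by (rule R.scale_left_commute)
    finally show ?thesis
      unfolding t .
  qed
  have "zeta s V \<Phi> i = t"
    unfolding zeta_def eigenvalue_on_def split_component_0 e(3)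
  proof (rule the_equality)
    show "\<forall>w\<in>range (\<lambda>c. s c e). split_operator s V \<Phi> i w = s t w"
      by (auto simp: split R.scale_left_commute)
    show "t' = t" if "\<forall>w\<in>range (\<lambda>c. s c e). split_operator s V \<Phi> i w = s t' w" for t'
    proof -
      have "s t e = s t' e"
        using that[rule_format, of e] range_eqI[of e "\<lambda>c. s c e" 1] split[of 1] by auto
      then show ?thesis
        using e(2) by simp
    qed
  qed
  then show ?thesis
    using t by simp
qed

end

section \<open>Transposition with respect to coordinates\<close>

definition seq_space :: "nat \<Rightarrow> (nat \<Rightarrow> 'k::field) set" where
  "seq_space n = {x. \<forall>i\<ge>n. x i = 0}"

definition unit_seq :: "nat \<Rightarrow> nat \<Rightarrow> 'k::field" where
  "unit_seq i = (\<lambda>j. if j = i then 1 else 0)"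

interpretation seq: vector_space seq_scale
  by (rule vector_space_seq_scale)

lemma carrier_space_seq: "carrier_space seq_scale (seq_space n)"
  by unfold_locales (auto intro!: seq.subspaceI simp: seq_space_def seq_scale_def)

lemma unit_seq_in: "i < n \<Longrightarrow> unit_seq i \<in> seq_space n"
  by (simp add: unit_seq_def seq_space_def)

lemma seq_expansion:
  assumes "x \<in> seq_space n"
  shows "x = (\<Sum>i<n. seq_scale (x i) (unit_seq i))"
proof
  fix j
  have "(\<Sum>i<n. seq_scale (x i) (unit_seq i)) j = (\<Sum>i<n. x i * (if i = j then 1 else 0))"
    by (induction n) (auto simp: seq_scale_def unit_seq_def)
  also have "\<dots> = (if j < n then x j else 0)"
    by (simp add: if_distrib cong: if_cong)
  finally show "x j = (\<Sum>i<n. seq_scale (x i) (unit_seq i)) j"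
    using assms by (simp add: seq_space_def)
qed

lemma fd_space_seq:
  assumes "0 < n"
  shows "fd_space seq_scale (seq_space n :: (nat \<Rightarrow> 'k::field) set)"
proof -
  interpret carrier_space seq_scale "seq_space n :: (nat \<Rightarrow> 'k) set"
    by (rule carrier_space_seq)
  let ?z = "unit_seq 0 :: nat \<Rightarrow> 'k"
  have "seq.span (unit_seq ` {..<n}) = (seq_space n :: (nat \<Rightarrow> 'k) set)"
  proof
    show "seq.span (unit_seq ` {..<n}) \<subseteq> (seq_space n :: (nat \<Rightarrow> 'k) set)"
      using unit_seq_in by (intro seq.span_minimal subspace_V) auto
    show "seq_space n \<subseteq> seq.span (unit_seq ` {..<n} :: (nat \<Rightarrow> 'k) set)"
    proof
      fix x :: "nat \<Rightarrow> 'k" assume "x \<in> seq_space n"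
      then have "x = (\<Sum>i<n. seq_scale (x i) (unit_seq i))"
        by (rule seq_expansion)
      also have "\<dots> \<in> seq.span (unit_seq ` {..<n})"
        by (intro seq.span_sum seq.span_scale seq.span_base) simp
      finally show "x \<in> seq.span (unit_seq ` {..<n})" .
    qed
  qed
  moreover have "?z \<noteq> 0" "?z \<in> seq_space n"
    using unit_seq_in[OF assms] by (auto simp: unit_seq_def fun_eq_iff)
  then have "(seq_space n :: (nat \<Rightarrow> 'k) set) \<noteq> {0}"
    by blast
  moreover have "finite (unit_seq ` {..<n} :: (nat \<Rightarrow> 'k) set)"
    by simp
  ultimately show ?thesis
    unfolding fd_space_def using vector_space_seq_scale subspace_V by blast
qed

text \<open>The functional is the coefficient at \<open>x\<close> in a basis of the ambient space
  extending \<open>x\<close> together with a basis of \<open>W\<close>.\<close>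

lemma (in vector_space) functional_vanishing_on_subspace:
  assumes "subspace W" "x \<notin> W"
  obtains f where "\<And>u v. f (u + v) = f u + f v" "\<And>c v. f (scale c v) = c * f v"
    "\<And>w. w \<in> W \<Longrightarrow> f w = 0" "f x = 1"
proof -
  obtain B where B: "B \<subseteq> W" "independent B" "W \<subseteq> span B"
    by (rule maximal_independent_subset)
  have "x \<notin> span B"
    using span_minimal[OF B(1) assms(1)] assms(2) by (rule contra_subsetD)
  then have ind: "independent (insert x B)"
    using B(2) by (rule independent_insertI)
  define C where "C = extend_basis (insert x B)"
  have C: "independent C" "span C = UNIV" "insert x B \<subseteq> C"
    unfolding C_def using ind
    by (rule independent_extend_basis span_extend_basis extend_basis_superset)+
  define f where "f v = representation C v x" for v
  have f_add: "f (u + v) = f u + f v" and f_scale: "f (scale c v) = c * f v" for u v c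
    using C by (simp_all add: f_def representation_add representation_scale)
  have fC: "f b = (if b = x then 1 else 0)" if "b \<in> insert x B" for b
    using C that representation_basis[OF C(1), of b] by (auto simp: f_def)
  have "x \<notin> B"
    using assms(2) B(1) by blast
  have "W \<subseteq> {v. f v = 0}"
  proof -
    have "subspace {v. f v = 0}"
      using f_scale[of 0 0] by (intro subspaceI) (auto simp: f_add f_scale)
    moreover have "B \<subseteq> {v. f v = 0}"
      using fC \<open>x \<notin> B\<close> by auto
    ultimately have "span B \<subseteq> {v. f v = 0}"
      by (intro span_minimal)
    then show ?thesis
      using B(3) by (rule subset_trans[rotated])
  qed
  then have "f w = 0" if "w \<in> W" for w
    using that by (rule CollectD[OF subsetD])
  moreover have "f x = 1"
    by (simp add: fC)
  ultimately show thesis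
    by (rule that[OF f_add f_scale])
qed

text \<open>The target of the isomorphism \<open>\<phi>\<close> serves twice: as coordinates for
  \<open>V\<close> and, through \<open>pairing\<close>, as the dual space of
  \<open>V\<close>.\<close>

locale coordinates = carrier_space s V
  for s :: "'k::field \<Rightarrow> 'v::ab_group_add \<Rightarrow> 'v" and V +
  fixes n :: nat and \<phi> :: "'v \<Rightarrow> nat \<Rightarrow> 'k"
  assumes bij: "bij_betw \<phi> V (seq_space n)"
    and coord_add: "u \<in> V \<Longrightarrow> v \<in> V \<Longrightarrow> \<phi> (u + v) = \<phi> u + \<phi> v"
    and coord_scale: "v \<in> V \<Longrightarrow> \<phi> (s c v) = seq_scale c (\<phi> v)"
begin

definition pairing :: "'v \<Rightarrow> (nat \<Rightarrow> 'k) \<Rightarrow> 'k" where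
  "pairing u x = (\<Sum>i<n. \<phi> u i * x i)"

definition basis_vec :: "nat \<Rightarrow> 'v" where
  "basis_vec i = inv_into V \<phi> (unit_seq i)"

text \<open>The transposed matrix of \<open>f\<close> in the basis formed by
  \<open>basis_vec\<close>. Restriction to \<open>seq_space n\<close> and padding by zeros make it
  an element of \<open>End_on\<close>.\<close>

definition transpose :: "('v \<Rightarrow> 'v) \<Rightarrow> (nat \<Rightarrow> 'k) \<Rightarrow> nat \<Rightarrow> 'k" where
  "transpose f = (\<lambda>x\<in>seq_space n. \<lambda>i. if i < n then pairing (f (basis_vec i)) x else 0)"

definition transpose_td :: "'v td_data \<Rightarrow> (nat \<Rightarrow> 'k) td_data" where
  "transpose_td \<Phi> = \<lparr>diam = diam \<Phi>, opA = transpose (opA \<Phi>), idE = \<lambda>i. transpose (idE \<Phi> i),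
     opAs = transpose (opAs \<Phi>), idEs = \<lambda>i. transpose (idEs \<Phi> i)\<rparr>"

sublocale T: carrier_space seq_scale "seq_space n"
  by (rule carrier_space_seq)

lemma coord_in: "v \<in> V \<Longrightarrow> \<phi> v \<in> seq_space n"
  using bij by (rule bij_betw_apply)

lemma coord_eqI: "u \<in> V \<Longrightarrow> v \<in> V \<Longrightarrow> \<phi> u = \<phi> v \<Longrightarrow> u = v"
  using bij_betw_imp_inj_on[OF bij] by (rule inj_onD)

lemma coord_zero: "\<phi> 0 = 0"
  using coord_scale[of 0 0] by simp

lemma coord_sum:
  "(\<And>i. i \<in> I \<Longrightarrow> g i \<in> V) \<Longrightarrow> \<phi> (sum g I) = (\<Sum>i\<in>I. \<phi> (g i))"
  by (induction I rule: infinite_finite_induct) (simp_all add: coord_zero coord_add V_sum)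

lemma basis_vec_in: "i < n \<Longrightarrow> basis_vec i \<in> V"
  and coord_basis_vec: "i < n \<Longrightarrow> \<phi> (basis_vec i) = unit_seq i"
  using unit_seq_in[of i n] bij
  unfolding basis_vec_def bij_betw_def by (metis inv_into_into, metis f_inv_into_f)

lemma expansion:
  assumes "v \<in> V"
  shows "v = (\<Sum>i<n. s (\<phi> v i) (basis_vec i))"
proof (rule coord_eqI)
  show "(\<Sum>i<n. s (\<phi> v i) (basis_vec i)) \<in> V"
    by (intro V_sum V_scale basis_vec_in) simp
  have "\<phi> (\<Sum>i<n. s (\<phi> v i) (basis_vec i)) = (\<Sum>i<n. \<phi> (s (\<phi> v i) (basis_vec i)))"
    by (intro coord_sum V_scale basis_vec_in) simp
  also have "\<dots> = (\<Sum>i<n. seq_scale (\<phi> v i) (unit_seq i))"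
    by (intro sum.cong refl) (simp add: coord_scale basis_vec_in coord_basis_vec)
  finally show "\<phi> v = \<phi> (\<Sum>i<n. s (\<phi> v i) (basis_vec i))"
    using seq_expansion[OF coord_in[OF assms]] by simp
qed (rule assms)

lemma pairing_add_left: "u \<in> V \<Longrightarrow> v \<in> V \<Longrightarrow> pairing (u + v) x = pairing u x + pairing v x"
  and pairing_scale_left: "u \<in> V \<Longrightarrow> pairing (s c u) x = c * pairing u x"
  and pairing_add_right: "pairing u (x + y) = pairing u x + pairing u y"
  and pairing_scale_right: "pairing u (seq_scale c x) = c * pairing u x"
  by (simp_all add: pairing_def coord_add coord_scale seq_scale_def algebra_simps sum.distrib
      sum_distrib_left)

lemma pairing_zero: "pairing 0 x = 0" "pairing u 0 = 0"
  by (simp_all add: pairing_def coord_zero)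

lemma pairing_diff_right: "pairing u (x - y) = pairing u x - pairing u y"
  by (simp add: pairing_def algebra_simps sum_subtractf)

lemma pairing_diff_left: "u \<in> V \<Longrightarrow> v \<in> V \<Longrightarrow> pairing (u - v) x = pairing u x - pairing v x"
  using pairing_add_left[of "u - v" v x] by (simp add: V_diff)

lemma pairing_sum_left:
  "(\<And>i. i \<in> I \<Longrightarrow> g i \<in> V) \<Longrightarrow> pairing (sum g I) x = (\<Sum>i\<in>I. pairing (g i) x)"
  by (induction I rule: infinite_finite_induct) (simp_all add: pairing_zero pairing_add_left V_sum)

lemma pairing_sum_right: "pairing u (sum g I) = (\<Sum>i\<in>I. pairing u (g i))"
  by (induction I rule: infinite_finite_induct) (simp_all only: not_False_eq_True sum.infinite sum.empty sum.insert pairing_zero pairing_add_right)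

lemma pairing_basis_vec:
  assumes "i < n"
  shows "pairing (basis_vec i) x = x i"
proof -
  have "pairing (basis_vec i) x = (\<Sum>j<n. if j = i then x j else 0)"
    unfolding pairing_def coord_basis_vec[OF assms] by (intro sum.cong) (auto simp: unit_seq_def)
  then show ?thesis
    using assms by simp
qed

lemma pairing_unit_seq:
  assumes "i < n"
  shows "pairing u (unit_seq i) = \<phi> u i"
proof -
  have "pairing u (unit_seq i) = (\<Sum>j<n. if j = i then \<phi> u j else 0)"
    unfolding pairing_def by (intro sum.cong) (auto simp: unit_seq_def)
  then show ?thesis
    using assms by simp
qed

lemma pairing_eqI_right:
  assumes "x \<in> seq_space n" "y \<in> seq_space n" "\<And>u. u \<in> V \<Longrightarrow> pairing u x = pairing u y"
  shows "x = y"
proof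
  fix i
  show "x i = y i"
    using assms(1,2) assms(3)[OF basis_vec_in, of i]
    by (cases "i < n") (auto simp: pairing_basis_vec seq_space_def)
qed

lemma pairing_nondegenerate_left:
  assumes "u \<in> V" "u \<noteq> 0"
  shows "\<exists>x\<in>seq_space n. pairing u x = 1"
proof -
  have "\<phi> u \<noteq> \<phi> 0"
    using coord_eqI[OF assms(1) V_zero] assms(2) by blast
  then obtain i where "\<phi> u i \<noteq> 0"
    by (auto simp: coord_zero fun_eq_iff)
  moreover have "i < n"
    using coord_in[OF assms(1)] calculation by (simp add: seq_space_def) (meson not_le)
  ultimately show ?thesis
    by (intro bexI[of _ "seq_scale (inverse (\<phi> u i)) (unit_seq i)"])
      (simp_all add: pairing_scale_right pairing_unit_seq T.V_scale unit_seq_in)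
qed

text \<open>A functional that kills \<open>W\<close> but not \<open>x\<close> agrees on
  \<open>seq_space n\<close> with the pairing by some \<open>u\<close>, whose coordinates are its
  values on the unit sequences. Its value 1 at \<open>x\<close> shows
  \<open>u \<noteq> 0\<close>.\<close>

lemma annihilator_nonzero:
  assumes "seq.subspace W" "W \<subseteq> seq_space n" "W \<noteq> seq_space n"
  obtains u where "u \<in> V" "u \<noteq> 0" "\<And>x. x \<in> W \<Longrightarrow> pairing u x = 0"
proof -
  obtain x where x: "x \<in> seq_space n" "x \<notin> W"
    using assms by blast
  obtain f where f: "\<And>y z. f (y + z) = f y + f z" "\<And>c y. f (seq_scale c y) = c * f y"
    "\<And>w. w \<in> W \<Longrightarrow> f w = 0" "f x = 1"
    using seq.functional_vanishing_on_subspace[OF assms(1) x(2)] by blast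
  have f0: "f 0 = 0"
    using f(2)[of 0 0] by simp
  have f_sum: "f (sum g I) = (\<Sum>i\<in>I. f (g i))" for g :: "nat \<Rightarrow> nat \<Rightarrow> 'k" and I
    by (induction I rule: infinite_finite_induct) (simp_all only: not_False_eq_True sum.infinite sum.empty sum.insert f(1) f0)
  define z where "z i = (if i < n then f (unit_seq i) else 0)" for i
  have "z \<in> seq_space n"
    by (simp add: z_def seq_space_def)
  then obtain u where u: "u \<in> V" "\<phi> u = z"
    using bij by (metis bij_betw_def imageE)
  have "pairing u y = f y" if "y \<in> seq_space n" for y
  proof -
    have "f y = (\<Sum>i<n. y i * f (unit_seq i))"
      by (subst seq_expansion[OF that]) (simp add: f_sum f(2))
    also have "\<dots> = pairing u y"
      unfolding pairing_def u(2) by (intro sum.cong) (auto simp: z_def)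
    finally show ?thesis
      by simp
  qed
  then have "pairing u x = 1" "\<And>y. y \<in> W \<Longrightarrow> pairing u y = 0"
    using x f(3,4) assms(2) by auto
  then show thesis
    using that[of u] u(1) by (metis pairing_zero(1) zero_neq_one)
qed

section \<open>The transpose as adjoint for the pairing\<close>

lemma transpose_in: "x \<in> seq_space n \<Longrightarrow> transpose f x \<in> seq_space n"
  by (simp add: transpose_def seq_space_def)

lemma transpose_End: "transpose f \<in> End_on seq_scale (seq_space n)"
proof (rule T.End_onI)
  show "transpose f \<in> extensional (seq_space n)"
    by (simp add: transpose_def)
  show "transpose f (x + y) = transpose f x + transpose f y"
    if "x \<in> seq_space n" "y \<in> seq_space n" for x y
    using that T.V_add[OF that]
    by (intro ext) (simp add: transpose_def pairing_add_right)
  show "transpose f (seq_scale c x) = seq_scale c (transpose f x)"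
    if "x \<in> seq_space n" for c x
    using that T.V_scale[OF that, of c]
    by (intro ext) (simp add: transpose_def pairing_scale_right, simp add: seq_scale_def)
qed (rule transpose_in)

lemma pairing_transpose:
  assumes f: "f \<in> End_on s V" and u: "u \<in> V" and x: "x \<in> seq_space n"
  shows "pairing u (transpose f x) = pairing (f u) x"
proof -
  have "f u = f (\<Sum>i<n. s (\<phi> u i) (basis_vec i))"
    using expansion[OF u] by simp
  also have "\<dots> = (\<Sum>i<n. f (s (\<phi> u i) (basis_vec i)))"
    by (rule End_on_sum[OF f]) (simp add: V_scale basis_vec_in)
  also have "\<dots> = (\<Sum>i<n. s (\<phi> u i) (f (basis_vec i)))"
    by (intro sum.cong refl) (simp add: End_on_scale[OF f] basis_vec_in)
  finally have "pairing (f u) x = pairing (\<Sum>i<n. s (\<phi> u i) (f (basis_vec i))) x"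
    by simp
  also have "\<dots> = (\<Sum>i<n. pairing (s (\<phi> u i) (f (basis_vec i))) x)"
    by (rule pairing_sum_left) (simp add: V_scale basis_vec_in End_on_in[OF f])
  also have "\<dots> = (\<Sum>i<n. \<phi> u i * pairing (f (basis_vec i)) x)"
    by (intro sum.cong refl) (simp add: pairing_scale_left basis_vec_in End_on_in[OF f])
  also have "\<dots> = pairing u (transpose f x)"
    unfolding pairing_def[of u] by (intro sum.cong refl) (simp add: transpose_def x)
  finally show ?thesis
    by simp
qed

text \<open>The outermost factor becomes innermost when it crosses the pairing;
  \<open>shift_prod_commute\<close> moves it back to the front.\<close>

lemma pairing_shift_prod:
  assumes f: "f \<in> End_on s V" and u: "u \<in> V" and x: "x \<in> seq_space n"
  shows "pairing u (shift_prod seq_scale (transpose f) c xs x) = pairing (shift_prod s f c xs u) x"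
  using u
proof (induction xs arbitrary: u)
  case (Cons j xs)
  let ?y = "shift_prod seq_scale (transpose f) c xs x"
  have y: "?y \<in> seq_space n"
    by (rule T.shift_prod_in[OF transpose_End x])
  have v: "f u - s (c j) u \<in> V"
    using Cons.prems by (simp add: V_closed End_on_in[OF f])
  have "pairing u (shift_prod seq_scale (transpose f) c (j # xs) x) = pairing (f u - s (c j) u) ?y"
    using Cons.prems y
    by (simp add: pairing_diff_right pairing_scale_right pairing_diff_left pairing_scale_left
        pairing_transpose[OF f] V_scale End_on_in[OF f])
  also have "\<dots> = pairing (shift_prod s f c xs (f u - s (c j) u)) x"
    by (rule Cons.IH[OF v])
  also have "\<dots> = pairing (shift_prod s f c (j # xs) u) x"
    using shift_prod_commute[OF f Cons.prems] by simp
  finally show ?case .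
qed simp

text \<open>Tested by pairing with vectors of \<open>V\<close>, each identity becomes one for the
  original maps with products reversed; the relation for \<open>A\<close> applied after
  \<open>E i\<close> turns into \<open>E_A\<close>. The eigenvalues do not change.\<close>

lemma spectral_resolution_transpose:
  assumes "spectral_resolution s V d A E \<theta>"
  shows "spectral_resolution seq_scale (seq_space n) d (transpose A) (\<lambda>i. transpose (E i)) \<theta>"
proof -
  interpret R: spectral_resolution s V d A E \<theta>
    by fact
  show ?thesis
  proof
    show "\<exists>x\<in>seq_space n. transpose (E i) x \<noteq> 0" if i: "i \<le> d" for i
    proof -
      obtain v where v: "v \<in> V" "E i v \<noteq> 0"
        using R.E_nonzero i by blast
      then obtain x where x: "x \<in> seq_space n" "pairing (E i v) x = 1"
        using pairing_nondegenerate_left R.E_in i by blast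
      then have "pairing v (transpose (E i) x) = 1"
        using v i by (simp add: pairing_transpose R.E_End)
      then have "transpose (E i) x \<noteq> 0"
        using pairing_zero by auto
      then show ?thesis
        using x by blast
    qed
    show "transpose (E i) (transpose (E j) x) = (if i = j then transpose (E j) x else 0)"
      if "i \<le> d" "j \<le> d" "x \<in> seq_space n" for i j x
    proof (rule pairing_eqI_right)
      show "pairing u (transpose (E i) (transpose (E j) x)) =
          pairing u (if i = j then transpose (E j) x else 0)" if "u \<in> V" for u
        using that \<open>i \<le> d\<close> \<open>j \<le> d\<close> \<open>x \<in> seq_space n\<close>
        by (simp add: pairing_transpose R.E_End R.E_in R.E_E transpose_in pairing_zero)
    qed (use that in \<open>auto simp: transpose_in\<close>)
    show "(\<Sum>i\<le>d. transpose (E i) x) = x" if x: "x \<in> seq_space n" for x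
    proof (rule pairing_eqI_right)
      show "pairing u (\<Sum>i\<le>d. transpose (E i) x) = pairing u x" if u: "u \<in> V" for u
      proof -
        have "pairing u (\<Sum>i\<le>d. transpose (E i) x) = (\<Sum>i\<le>d. pairing (E i u) x)"
          unfolding pairing_sum_right
          by (intro sum.cong refl) (simp add: pairing_transpose R.E_End u x)
        also have "\<dots> = pairing (\<Sum>i\<le>d. E i u) x"
          by (rule pairing_sum_left[symmetric]) (simp add: R.E_in u)
        finally show ?thesis
          by (simp add: R.sum_E u)
      qed
    qed (use x in \<open>auto intro!: T.V_sum transpose_in\<close>)
    show "transpose A (transpose (E i) x) = seq_scale (\<theta> i) (transpose (E i) x)"
      if "i \<le> d" "x \<in> seq_space n" for i x
    proof (rule pairing_eqI_right)
      show "pairing u (transpose A (transpose (E i) x)) =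
          pairing u (seq_scale (\<theta> i) (transpose (E i) x))" if "u \<in> V" for u
        using that \<open>i \<le> d\<close> \<open>x \<in> seq_space n\<close>
        by (simp add: pairing_transpose R.E_End R.A_End R.E_in R.A_in R.E_A transpose_in
            pairing_scale_right pairing_scale_left)
    qed (use that in \<open>auto intro!: T.V_scale transpose_in\<close>)
  qed (rule transpose_End R.inj_theta)+
qed

lemma transpose_triple_zero:
  assumes "f \<in> End_on s V" "g \<in> End_on s V" "h \<in> End_on s V" "x \<in> seq_space n"
    "\<And>u. u \<in> V \<Longrightarrow> h (g (f u)) = 0"
  shows "transpose f (transpose g (transpose h x)) = 0"
  using assms
  by (intro pairing_eqI_right) (simp_all add: pairing_transpose transpose_in End_on_in pairing_zero)

text \<open>Irreducibility passes to the dual through annihilators. The vectors orthogonal to an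
  invariant \<open>W\<close> form an invariant subspace of \<open>V\<close>: if it is zero,
  \<open>W\<close> is everything by \<open>annihilator_nonzero\<close>, and if it is
  \<open>V\<close>, then \<open>W\<close> is zero.\<close>

lemma td_resolution_transpose:
  assumes "td_resolution s V \<Phi> \<theta> \<theta>'"
  shows "td_resolution seq_scale (seq_space n) (transpose_td \<Phi>) \<theta> \<theta>'"
proof -
  interpret P: td_resolution s V \<Phi> \<theta> \<theta>'
    by fact
  have "td_resolution_axioms seq_scale (seq_space n) (transpose_td \<Phi>)"
  proof (rule td_resolution_axioms.intro, unfold transpose_td_def td_data.simps)
    \<comment> \<open>Reversing the product exchanges \<open>i\<close> and \<open>j\<close>, which
      the distance condition tolerates after swapping its two disjuncts.\<close>
    show "transpose (idE \<Phi> j) (transpose (opAs \<Phi>) (transpose (idE \<Phi> i) x)) = 0"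
      if "i \<le> diam \<Phi>" "j \<le> diam \<Phi>" "x \<in> seq_space n" "i + 1 < j \<or> j + 1 < i" for i j x
      using that(1-3)
      by (intro transpose_triple_zero P.R.E_End P.S.A_End P.tri disj_commute[THEN iffD1, OF that(4)])
    show "transpose (idEs \<Phi> j) (transpose (opA \<Phi>) (transpose (idEs \<Phi> i) x)) = 0"
      if "i \<le> diam \<Phi>" "j \<le> diam \<Phi>" "x \<in> seq_space n" "i + 1 < j \<or> j + 1 < i" for i j x
      using that(1-3)
      by (intro transpose_triple_zero P.S.E_End P.R.A_End P.tri_s disj_commute[THEN iffD1, OF that(4)])
    fix W :: "(nat \<Rightarrow> 'k) set"
    assume W: "seq.subspace W" "W \<subseteq> seq_space n"
      and inv: "transpose (opA \<Phi>) ` W \<subseteq> W" "transpose (opAs \<Phi>) ` W \<subseteq> W"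
    define N where "N = {u \<in> V. \<forall>x\<in>W. pairing u x = 0}"
    have subN: "subspace N"
      by (intro subspaceI) (auto simp: N_def V_closed pairing_zero pairing_add_left pairing_scale_left)
    have invN: "f ` N \<subseteq> N" if f: "f \<in> End_on s V" "transpose f ` W \<subseteq> W" for f
    proof
      fix v assume "v \<in> f ` N"
      then obtain u where u: "u \<in> N" "v = f u"
        by blast
      have "pairing (f u) x = 0" if x: "x \<in> W" for x
      proof -
        have "transpose f x \<in> W" "x \<in> seq_space n"
          using f(2) W(2) x by blast+
        then show ?thesis
          using pairing_transpose[OF f(1), of u x] u(1) by (simp add: N_def)
      qed
      then show "v \<in> N"
        using u End_on_in[OF f(1)] by (simp add: N_def)
    qed
    have "N = {0} \<or> N = V"
      using subN _ invN[OF P.R.A_End inv(1)] invN[OF P.S.A_End inv(2)]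
      by (rule P.irreducible) (auto simp: N_def)
    then show "W = {0} \<or> W = seq_space n"
    proof
      assume "N = {0}"
      have "W = seq_space n"
      proof (rule ccontr)
        assume "W \<noteq> seq_space n"
        then obtain u where "u \<in> V" "u \<noteq> 0" "\<And>x. x \<in> W \<Longrightarrow> pairing u x = 0"
          using annihilator_nonzero[OF W] by blast
        then have "u \<in> N" "u \<noteq> 0"
          by (simp_all add: N_def)
        with \<open>N = {0}\<close> show False
          by simp
      qed
      then show ?thesis ..
    next
      assume N: "N = V"
      have "x = 0" if x: "x \<in> W" for x
      proof (rule pairing_eqI_right)
        show "pairing u x = pairing u 0" if "u \<in> V" for u
          using that N x by (simp add: N_def pairing_zero) blast
      qed (use x W in auto)
      then have "W = {0}"
        using seq.subspace_0[OF W(1)] by blast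
      then show ?thesis ..
    qed
  qed
  then show ?thesis
    using spectral_resolution_transpose[OF P.R.spectral_resolution_axioms]
      spectral_resolution_transpose[OF P.S.spectral_resolution_axioms]
    by (intro td_resolution.intro) (simp_all add: transpose_td_def)
qed

text \<open>A map of rank one sends each \<open>u\<close> to a multiple of a fixed \<open>g\<close>,
  so its transpose sends \<open>x\<close> to \<open>pairing g x\<close> times a fixed vector. With
  \<open>pairing g x0 = 1\<close> that vector is \<open>transpose f x0\<close>.\<close>

lemma dim_image_transpose:
  assumes f: "f \<in> End_on s V" and dim: "subspace (f ` V)" "dim (f ` V) = 1"
  shows "seq.dim (transpose f ` seq_space n) = 1"
proof -
  obtain g where g: "g \<in> f ` V" "g \<noteq> 0" "f ` V = range (\<lambda>c. s c g)"
    using dim_eq_1_obtain[OF dim] .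
  obtain u0 where u0: "u0 \<in> V" "g = f u0"
    using g(1) by blast
  have gV: "g \<in> V"
    using u0 End_on_in[OF f] by simp
  obtain x0 where x0: "x0 \<in> seq_space n" "pairing g x0 = 1"
    using pairing_nondegenerate_left[OF gV g(2)] by blast
  have eq: "transpose f x = seq_scale (pairing g x) (transpose f x0)" if x: "x \<in> seq_space n" for x
  proof (rule pairing_eqI_right)
    show "pairing u (transpose f x) = pairing u (seq_scale (pairing g x) (transpose f x0))"
      if u: "u \<in> V" for u
    proof -
      have "f u \<in> range (\<lambda>c. s c g)"
        unfolding g(3)[symmetric] using u by (rule imageI)
      then obtain c where "f u = s c g"
        by (elim rangeE)
      then show ?thesis
        by (simp add: pairing_transpose[OF f] u x x0 pairing_scale_right pairing_scale_left gV)
    qed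
  qed (use x x0 in \<open>auto intro!: T.V_scale transpose_in\<close>)
  have "pairing u0 (transpose f x0) = 1"
    using pairing_transpose[OF f u0(1) x0(1)] u0(2) x0(2) by simp
  then have "transpose f x0 \<noteq> 0"
    using pairing_zero by auto
  moreover have "transpose f ` seq_space n = range (\<lambda>c. seq_scale c (transpose f x0))"
  proof
    show "transpose f ` seq_space n \<subseteq> range (\<lambda>c. seq_scale c (transpose f x0))"
      using eq by blast
    show "range (\<lambda>c. seq_scale c (transpose f x0)) \<subseteq> transpose f ` seq_space n"
    proof clarify
      fix c
      show "seq_scale c (transpose f x0) \<in> transpose f ` seq_space n"
        using T.V_scale[OF x0(1), of c] T.End_on_scale[OF transpose_End x0(1), of f c]
        by (intro rev_image_eqI[of "seq_scale c x0"]) simp_all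
    qed
  qed
  ultimately show ?thesis
    by (intro seq.dim_eq_1I)
qed

text \<open>Take spanning vectors \<open>e\<close> and \<open>x\<close> of the two lines and
  evaluate \<open>zeta\<close> through \<open>pairing e x\<close>. The projection
  \<open>Es 0\<close> disappears on one side and reappears on the other because it fixes
  \<open>e\<close> and its transpose fixes \<open>x\<close>; the product in \<open>A\<close> crosses
  by \<open>pairing_shift_prod\<close>.\<close>

lemma zeta_transpose:
  assumes P: "td_resolution s V \<Phi> \<theta> \<theta>'" and dim: "dim (idE \<Phi> 0 ` V) = 1" and i: "i \<le> diam \<Phi>"
  shows "zeta seq_scale (seq_space n) (transpose_td \<Phi>) i = zeta s V \<Phi> i"
proof -
  interpret P: td_resolution s V \<Phi> \<theta> \<theta>'
    by fact
  interpret Q: td_resolution seq_scale "seq_space n" "transpose_td \<Phi>" \<theta> \<theta>'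
    by (rule td_resolution_transpose[OF P])
  note [simp] = transpose_td_def
  have dimQ: "seq.dim (idE (transpose_td \<Phi>) 0 ` seq_space n) = 1"
    using dim_image_transpose[OF P.R.E_End P.R.subspace_image_E dim] by simp
  obtain e where e: "e \<in> V" "e \<noteq> 0" "idEs \<Phi> 0 ` V = range (\<lambda>c. s c e)"
    by (rule P.image_Es0[OF dim])
  obtain x where x: "x \<in> seq_space n" "x \<noteq> 0"
    "idEs (transpose_td \<Phi>) 0 ` seq_space n = range (\<lambda>c. seq_scale c x)"
    by (rule Q.image_Es0[OF dimQ])
  have fix_e: "idEs \<Phi> 0 e = e"
  proof -
    have "e \<in> idEs \<Phi> 0 ` V"
      unfolding e(3) by (rule range_eqI[of _ _ 1]) simp
    then show ?thesis
      using P.S.image_E[of 0] by simp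
  qed
  have fix_x: "transpose (idEs \<Phi> 0) x = x"
  proof -
    have "x \<in> idEs (transpose_td \<Phi>) 0 ` seq_space n"
      unfolding x(3) by (rule range_eqI[of _ _ 1]) simp
    then show ?thesis
      using Q.S.image_E[of 0] by simp
  qed
  let ?p = "\<Prod>j\<leftarrow>[1..<Suc i]. \<theta>' 0 - \<theta>' j"
  let ?u = "shift_prod s (opA \<Phi>) \<theta> (rev [0..<i]) e"
  let ?y = "shift_prod seq_scale (transpose (opA \<Phi>)) \<theta> (rev [0..<i]) x"
  have uy: "?u \<in> V" "?y \<in> seq_space n"
    using shift_prod_in[OF P.R.A_End e(1)] T.shift_prod_in[OF transpose_End x(1)] by blast+
  have Es0: "idEs \<Phi> 0 \<in> End_on s V"
    by (rule P.S.E_End) simp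
  \<comment> \<open>Some \<open>y\<close> pairs with \<open>e\<close> to 1. As \<open>Es 0\<close>
    fixes \<open>e\<close>, the image of \<open>y\<close> under the transposed projection still
    does, and that image is a multiple of \<open>x\<close>.\<close>
  have ne: "pairing e x \<noteq> 0"
  proof -
    obtain y where y: "y \<in> seq_space n" "pairing e y = 1"
      using pairing_nondegenerate_left[OF e(1,2)] by blast
    have "transpose (idEs \<Phi> 0) y \<in> range (\<lambda>c. seq_scale c x)"
      unfolding x(3)[symmetric] using y(1) by simp
    then obtain c where c: "transpose (idEs \<Phi> 0) y = seq_scale c x"
      by (elim rangeE)
    have "c * pairing e x = 1"
      using pairing_transpose[OF Es0 e(1) y(1)] y(2) by (simp add: c fix_e pairing_scale_right)
    then show ?thesis
      by auto
  qed
  have "zeta s V \<Phi> i * pairing e x = pairing (s (zeta s V \<Phi> i) e) x"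
    using e(1) by (simp add: pairing_scale_left)
  also have "\<dots> = pairing (s ?p (idEs \<Phi> 0 ?u)) x"
    unfolding P.zeta_eq[OF e i] ..
  also have "\<dots> = ?p * pairing ?u x"
    unfolding pairing_scale_left[OF End_on_in[OF Es0 uy(1)]]
      pairing_transpose[OF Es0 uy(1) x(1), symmetric] fix_x ..
  also have "\<dots> = ?p * pairing e ?y"
    unfolding pairing_shift_prod[OF P.R.A_End e(1) x(1)] ..
  also have "\<dots> = pairing e (seq_scale ?p (transpose (idEs \<Phi> 0) ?y))"
    unfolding pairing_scale_right pairing_transpose[OF Es0 e(1) uy(2)] fix_e ..
  also have "\<dots> = pairing e (seq_scale (zeta seq_scale (seq_space n) (transpose_td \<Phi>) i) x)"
    using Q.zeta_eq[OF x] i by simp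
  also have "\<dots> = zeta seq_scale (seq_space n) (transpose_td \<Phi>) i * pairing e x"
    by (rule pairing_scale_right)
  finally show ?thesis
    using ne by simp
qed

theorem sharp_td_system_transpose:
  assumes "sharp_td_system s V \<Phi>"
  shows "sharp_td_system seq_scale (seq_space n) (transpose_td \<Phi>)"
    and "parameter_array seq_scale (seq_space n) (transpose_td \<Phi>) = parameter_array s V \<Phi>"
proof -
  have td: "td_system s V \<Phi>" and dim: "dim (idE \<Phi> 0 ` V) = 1"
    using assms by (simp_all add: sharp_td_system_def)
  obtain \<theta> \<theta>' where P: "td_resolution s V \<Phi> \<theta> \<theta>'"
    using td_system_imp_resolution[OF carrier_space_axioms td] by (elim exE)
  interpret P: td_resolution s V \<Phi> \<theta> \<theta>'
    by (rule P)
  interpret Q: td_resolution seq_scale "seq_space n" "transpose_td \<Phi>" \<theta> \<theta>'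
    by (rule td_resolution_transpose[OF P])
  have d: "diam (transpose_td \<Phi>) = diam \<Phi>"
    by (simp add: transpose_td_def)
  show "sharp_td_system seq_scale (seq_space n) (transpose_td \<Phi>)"
    unfolding sharp_td_system_def
  proof
    show "seq.dim (idE (transpose_td \<Phi>) 0 ` seq_space n) = 1"
      using dim_image_transpose[OF P.R.E_End P.R.subspace_image_E dim] by (simp add: transpose_td_def)
  qed (rule Q.td_system)
  show "parameter_array seq_scale (seq_space n) (transpose_td \<Phi>) = parameter_array s V \<Phi>"
    unfolding parameter_array_def d
    by (intro arg_cong2[where f = Pair] map_cong refl)
      (simp_all add: P.theta_eq P.theta_s_eq Q.theta_eq Q.theta_s_eq zeta_transpose[OF P dim] d del: upt_Suc)
qed

end

section \<open>Coordinates from a finite basis\<close>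

lemma coordinates_exist:
  assumes "fd_space s V"
  obtains n \<phi> where "0 < n" "coordinates s V n \<phi>"
proof -
  have vs: "vector_space s" and sub: "module.subspace s V" and nz: "V \<noteq> {0}"
    and fin: "\<exists>B. finite B \<and> module.span s B = V"
    using assms by (simp_all add: fd_space_def)
  interpret vector_space s by (rule vs)
  interpret carrier_space s V by unfold_locales (rule sub)
  obtain B0 where B0: "finite B0" "span B0 = V"
    using fin by blast
  obtain B where B: "B \<subseteq> V" "independent B" "V \<subseteq> span B"
    by (rule maximal_independent_subset)
  have finB: "finite B"
    using independent_span_bound[OF B0(1) B(2)] B(1) B0(2) by simp
  have ne: "B \<noteq> {}"
    using B(3) nz V_zero by (metis empty_iff span_empty subset_singletonD)
  define n where "n = card B"
  obtain h where h: "bij_betw h {0..<n} B"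
    using ex_bij_betw_nat_finite[OF finB] n_def by blast
  have hB: "h i \<in> B" if "i < n" for i
    using bij_betwE[OF h] that by simp
  have spanV: "v \<in> span B" if "v \<in> V" for v
    using B(3) that by (rule subsetD)
  define \<phi> where "\<phi> v = (\<lambda>i. if i < n then representation B v (h i) else 0)" for v
  have rep_h: "representation B (h i) (h j) = (if j = i then 1 else 0)" if "i < n" "j < n" for i j
    using representation_basis[OF B(2) hB[OF that(1)]] inj_onD[OF bij_betw_imp_inj_on[OF h], of j i] that
    by auto
  have "inj_on \<phi> V"
  proof (rule inj_onI)
    fix u v assume uv: "u \<in> V" "v \<in> V" "\<phi> u = \<phi> v"
    have "representation B u b = representation B v b" if b: "b \<in> B" for b
    proof -
      obtain i where i: "i < n" "b = h i"
        using b unfolding bij_betw_imp_surj_on[OF h, symmetric] by auto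
      then show ?thesis
        using fun_cong[OF uv(3), of i] by (simp add: \<phi>_def)
    qed
    then have "(\<Sum>b\<in>B. s (representation B u b) b) = (\<Sum>b\<in>B. s (representation B v b) b)"
      by simp
    then show "u = v"
      unfolding sum_representation_eq[OF B(2) spanV[OF uv(1)] finB subset_refl]
        sum_representation_eq[OF B(2) spanV[OF uv(2)] finB subset_refl] .
  qed
  moreover have "x \<in> \<phi> ` V" if x: "x \<in> seq_space n" for x
  proof (rule rev_image_eqI)
    let ?v = "\<Sum>i<n. s (x i) (h i)"
    have hV: "h i \<in> V" if "i < n" for i
      using B(1) hB[OF that] by (rule subsetD)
    then show "?v \<in> V"
      by (intro V_sum V_scale) simp
    have rep: "representation B ?v = (\<lambda>b. \<Sum>i<n. x i * representation B (h i) b)"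
      using hV by (subst representation_sum[OF B(2)])
        (auto simp: representation_scale[OF B(2)] spanV V_scale intro!: sum.cong)
    show "x = \<phi> ?v"
    proof
      fix j
      have "(\<Sum>i<n. x i * representation B (h i) (h j)) = (\<Sum>i<n. if i = j then x i else 0)" if "j < n"
        using that by (intro sum.cong) (auto simp: rep_h)
      then show "x j = \<phi> ?v j"
        using x by (simp add: \<phi>_def rep seq_space_def)
    qed
  qed
  moreover have "\<phi> v \<in> seq_space n" for v
    by (simp add: \<phi>_def seq_space_def)
  ultimately have "bij_betw \<phi> V (seq_space n)"
    unfolding bij_betw_def by blast
  then have "coordinates s V n \<phi>"
    by unfold_locales
      (simp_all add: \<phi>_def fun_eq_iff representation_add representation_scale B(2) spanV seq_scale_def)
  moreover have "0 < n"
    using ne finB by (simp add: n_def card_gt_0_iff)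
  ultimately show thesis
    by (rule that[rotated])
qed

section \<open>Invariant forms\<close>

text \<open>Nonvanishing is left out so that differences of invariant forms, which may be zero,
  remain covered.\<close>

definition invariant_form ::
  "('k::field \<Rightarrow> 'v::ab_group_add \<Rightarrow> 'v) \<Rightarrow> 'v set \<Rightarrow> 'v td_data \<Rightarrow> ('v \<Rightarrow> 'v \<Rightarrow> 'k) \<Rightarrow> bool" where
  "invariant_form s V \<Phi> b \<longleftrightarrow> bilinear_form s V b \<and>
     (\<forall>u\<in>V. \<forall>v\<in>V. b (opA \<Phi> u) v = b u (opA \<Phi> v) \<and> b (opAs \<Phi> u) v = b u (opAs \<Phi> v))"

lemma nonzero_invariant_form_iff:
  "nonzero_invariant_form s V \<Phi> b \<longleftrightarrow> invariant_form s V \<Phi> b \<and> (\<exists>u\<in>V. \<exists>v\<in>V. b u v \<noteq> 0)"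
  by (auto simp: nonzero_invariant_form_def invariant_form_def)

lemma invariant_form_flip:
  "invariant_form s V \<Phi> b \<Longrightarrow> invariant_form s V \<Phi> (\<lambda>u v. b v u)"
  by (simp add: invariant_form_def bilinear_form_def)

lemma invariant_form_diff:
  "invariant_form s V \<Phi> b \<Longrightarrow> invariant_form s V \<Phi> b' \<Longrightarrow>
    invariant_form s V \<Phi> (\<lambda>u v. b' u v - c * b u v)"
  by (simp add: invariant_form_def bilinear_form_def algebra_simps)

section \<open>Radical, uniqueness and symmetry of invariant forms\<close>

context
  fixes s :: "'k::field \<Rightarrow> 'v::ab_group_add \<Rightarrow> 'v" and V \<Phi> b
  assumes b: "invariant_form s V \<Phi> b"
begin

lemma form_add_left: "u \<in> V \<Longrightarrow> v \<in> V \<Longrightarrow> w \<in> V \<Longrightarrow> b (u + v) w = b u w + b v w"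
  and form_add_right: "u \<in> V \<Longrightarrow> v \<in> V \<Longrightarrow> w \<in> V \<Longrightarrow> b w (u + v) = b w u + b w v"
  and form_scale_left: "u \<in> V \<Longrightarrow> v \<in> V \<Longrightarrow> b (s c u) v = c * b u v"
  and form_scale_right: "u \<in> V \<Longrightarrow> v \<in> V \<Longrightarrow> b u (s c v) = c * b u v"
  and form_A: "u \<in> V \<Longrightarrow> v \<in> V \<Longrightarrow> b (opA \<Phi> u) v = b u (opA \<Phi> v)"
  and form_As: "u \<in> V \<Longrightarrow> v \<in> V \<Longrightarrow> b (opAs \<Phi> u) v = b u (opAs \<Phi> v)"
  using b by (simp_all add: invariant_form_def bilinear_form_def)

end

context td_resolution
begin

lemma form_zero:
  assumes "invariant_form s V \<Phi> b" "v \<in> V"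
  shows "b 0 v = 0" "b v 0 = 0"
  using form_scale_left[OF assms(1), of 0 v 0] form_scale_right[OF assms(1), of v 0 0] assms(2)
  by simp_all

text \<open>Invariance moves \<open>A\<close> and \<open>As\<close> to the second argument, so the
  left radical is stable under both and irreducibility applies.\<close>

lemma radical_trivial:
  assumes b: "invariant_form s V \<Phi> b"
  shows "{u \<in> V. \<forall>v\<in>V. b u v = 0} = {0} \<or> {u \<in> V. \<forall>v\<in>V. b u v = 0} = V" (is "?N = _ \<or> _")
proof (rule irreducible)
  show "R.subspace ?N"
    by (intro R.subspaceI)
      (auto simp: R.V_closed form_zero[OF b] form_add_left[OF b] form_scale_left[OF b])
  show "A ` ?N \<subseteq> ?N" "As ` ?N \<subseteq> ?N"
    by (auto simp: R.A_in S.A_in form_A[OF b] form_As[OF b])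
qed auto

lemma nondegenerate_left:
  assumes "nonzero_invariant_form s V \<Phi> b" "u \<in> V" "\<And>v. v \<in> V \<Longrightarrow> b u v = 0"
  shows "u = 0"
proof -
  have "{u \<in> V. \<forall>v\<in>V. b u v = 0} \<noteq> V"
    using assms(1) unfolding nonzero_invariant_form_iff by fast
  then have "{u \<in> V. \<forall>v\<in>V. b u v = 0} = {0}"
    using radical_trivial[of b] assms(1) nonzero_invariant_form_iff by metis
  moreover have "u \<in> {u \<in> V. \<forall>v\<in>V. b u v = 0}"
    using assms(2,3) by simp
  ultimately show ?thesis
    by (metis singletonD)
qed

text \<open>The second argument is handled by the flipped form, which is again invariant and
  nonzero.\<close>

lemma nondegenerate:
  assumes b: "nonzero_invariant_form s V \<Phi> b"
  shows "nondegenerate_form V b"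
proof -
  have flip: "nonzero_invariant_form s V \<Phi> (\<lambda>u v. b v u)"
    using b invariant_form_flip by (fastforce simp: nonzero_invariant_form_iff)
  show ?thesis
    unfolding nondegenerate_form_def
    using nondegenerate_left[OF b] nondegenerate_left[OF flip] by (intro conjI ballI impI) simp_all
qed

text \<open>
  Eigenvectors of \<open>A\<^sup>*\<close> for distinct eigenvalues are orthogonal, so \<open>b e e = 0\<close> puts \<open>e\<close> in the radical.
\<close>

lemma form_vanishes:
  assumes e: "e \<in> V" "e \<noteq> 0" "Es 0 ` V = range (\<lambda>c. s c e)"
    and b: "invariant_form s V \<Phi> b" and bee: "b e e = 0" and uv: "u \<in> V" "v \<in> V"
  shows "b u v = 0"
proof -
  have "e \<in> Es 0 ` V"
    unfolding e(3) by (rule range_eqI[of _ _ 1]) simp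
  then have As_e: "As e = s (\<theta>' 0) e"
    using S.image_E_eigenspace[of 0] by simp
  have ortho: "b e (Es j w) = 0" if j: "j \<le> d" and w: "w \<in> V" for j w
  proof (cases "j = 0")
    case True
    have "Es 0 w \<in> range (\<lambda>c. s c e)"
      unfolding e(3)[symmetric] using w by (rule imageI)
    then obtain c where "Es 0 w = s c e"
      by (elim rangeE)
    then show ?thesis
      using True form_scale_right[OF b e(1) e(1)] bee by simp
  next
    case False
    have x: "Es j w \<in> V"
      by (rule S.E_in[OF j w])
    have "\<theta>' 0 * b e (Es j w) = b (As e) (Es j w)"
      unfolding As_e form_scale_left[OF b e(1) x] ..
    also have "\<dots> = b e (s (\<theta>' j) (Es j w))"
      unfolding form_As[OF b e(1) x] S.A_E[OF j w] ..
    also have "\<dots> = \<theta>' j * b e (Es j w)"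
      by (rule form_scale_right[OF b e(1) x])
    finally show ?thesis
      using inj_onD[OF S.inj_theta, of 0 j] j False by auto
  qed
  have "b e w = 0" if w: "w \<in> V" for w
  proof -
    have "b e (\<Sum>j\<in>J. Es j w) = 0" if "finite J" "J \<subseteq> {..d}" for J
      using that
    proof (induction J rule: finite_induct)
      case (insert j J)
      have "(\<Sum>j\<in>J. Es j w) \<in> V" "Es j w \<in> V"
        using insert.prems w by (auto intro!: R.V_sum S.E_in)
      then show ?case
        using insert w e(1) by (simp add: form_add_right[OF b] ortho)
    qed (simp add: form_zero[OF b e(1)])
    from this[of "{..d}"] show ?thesis
      by (simp add: S.sum_E w)
  qed
  then have eN: "e \<in> {u \<in> V. \<forall>v\<in>V. b u v = 0}"
    using e(1) by simp
  have "{u \<in> V. \<forall>v\<in>V. b u v = 0} \<noteq> {0}"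
  proof
    assume "{u \<in> V. \<forall>v\<in>V. b u v = 0} = {0}"
    from eN[unfolded this] e(2) show False
      by simp
  qed
  with radical_trivial[OF b] have "{u \<in> V. \<forall>v\<in>V. b u v = 0} = V"
    by (simp only: simp_thms)
  then have "u \<in> {u \<in> V. \<forall>v\<in>V. b u v = 0}"
    using uv(1) by (rule ssubst)
  then show ?thesis
    using uv(2) by simp
qed

text \<open>By \<open>form_vanishes\<close>, \<open>b e e\<close> is nonzero, so a multiple of
  \<open>b\<close> can be subtracted from \<open>b'\<close> to make the difference vanish at
  \<open>e\<close>, \<open>e\<close>. The difference is then zero by the same lemma.\<close>

lemma form_unique:
  assumes dim: "R.dim (E 0 ` V) = 1"
    and b: "nonzero_invariant_form s V \<Phi> b" and b': "nonzero_invariant_form s V \<Phi> b'"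
  shows "\<exists>c. c \<noteq> 0 \<and> (\<forall>u\<in>V. \<forall>v\<in>V. b' u v = c * b u v)"
proof -
  obtain e where e: "e \<in> V" "e \<noteq> 0" "Es 0 ` V = range (\<lambda>c. s c e)"
    by (rule image_Es0[OF dim])
  have inv: "invariant_form s V \<Phi> b" "invariant_form s V \<Phi> b'"
    using b b' by (simp_all add: nonzero_invariant_form_iff)
  have ne: "b e e \<noteq> 0"
    using form_vanishes[OF e inv(1)] b unfolding nonzero_invariant_form_iff by metis
  define c where "c = b' e e / b e e"
  have "b' e e - c * b e e = 0"
    using ne by (simp add: c_def)
  then have eq: "b' u v = c * b u v" if "u \<in> V" "v \<in> V" for u v
    using form_vanishes[OF e invariant_form_diff[OF inv], of c] that by simp
  moreover have "c \<noteq> 0"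
    using b' eq unfolding nonzero_invariant_form_iff by force
  ultimately show ?thesis
    by blast
qed

text \<open>The difference of \<open>b\<close> and its flip is invariant and vanishes at
  \<open>e\<close>, \<open>e\<close>, hence everywhere.\<close>

lemma form_symmetric:
  assumes dim: "R.dim (E 0 ` V) = 1" and b: "nonzero_invariant_form s V \<Phi> b"
  shows "symmetric_form V b"
proof -
  obtain e where e: "e \<in> V" "e \<noteq> 0" "Es 0 ` V = range (\<lambda>c. s c e)"
    by (rule image_Es0[OF dim])
  have inv: "invariant_form s V \<Phi> b"
    using b by (simp add: nonzero_invariant_form_iff)
  show ?thesis
    unfolding symmetric_form_def
    using form_vanishes[OF e invariant_form_diff[OF invariant_form_flip[OF inv] inv], of 1] by simp
qed

end

text \<open>
  Since \<open>\<sigma>\<close> is an isomorphism of algebras, \<open>y \<mapsto> \<sigma> (x \<mapsto> x\<^sub>0 y) z\<close> is linear in \<open>y\<close> and intertwines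
  \<open>f\<close> with \<open>\<sigma> f\<close>; for a suitable \<open>z\<close> it is nonzero.
\<close>

lemma End_iso_intertwiner:
  fixes \<sigma> :: "((nat \<Rightarrow> 'k::field) \<Rightarrow> nat \<Rightarrow> 'k) \<Rightarrow> (nat \<Rightarrow> 'k) \<Rightarrow> nat \<Rightarrow> 'k"
  assumes \<sigma>: "End_iso seq_scale (seq_space n) seq_scale (seq_space n) \<sigma>" and n: "0 < n"
  obtains K where "\<forall>y\<in>seq_space n. K y \<in> seq_space n"
    "\<forall>x\<in>seq_space n. \<forall>y\<in>seq_space n. K (x + y) = K x + K y"
    "\<forall>c. \<forall>y\<in>seq_space n. K (seq_scale c y) = seq_scale c (K y)"
    "\<forall>f\<in>End_on seq_scale (seq_space n). \<forall>y\<in>seq_space n. K (f y) = \<sigma> f (K y)"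
    "\<exists>y\<in>seq_space n. K y \<noteq> 0"
proof -
  let ?V = "seq_space n :: (nat \<Rightarrow> 'k) set"
  let ?End = "End_on seq_scale ?V"
  interpret T: carrier_space seq_scale ?V
    by (rule carrier_space_seq)
  have bij: "bij_betw \<sigma> ?End ?End"
    and add: "\<And>f g. f \<in> ?End \<Longrightarrow> g \<in> ?End \<Longrightarrow> \<sigma> (\<lambda>v\<in>?V. f v + g v) = (\<lambda>v\<in>?V. \<sigma> f v + \<sigma> g v)"
    and scale: "\<And>c f. f \<in> ?End \<Longrightarrow> \<sigma> (\<lambda>v\<in>?V. seq_scale c (f v)) = (\<lambda>v\<in>?V. seq_scale c (\<sigma> f v))"
    and mult: "\<And>f g. f \<in> ?End \<Longrightarrow> g \<in> ?End \<Longrightarrow> \<sigma> (compose ?V f g) = compose ?V (\<sigma> f) (\<sigma> g)"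
    using \<sigma> by (simp_all add: End_iso_def)
  have \<sigma>_End: "\<sigma> f \<in> ?End" if "f \<in> ?End" for f
    using bij that by (rule bij_betw_apply)
  \<comment> \<open>Maps of rank at most one; \<open>y\<close> is recovered from \<open>X y\<close>
    as its value at \<open>unit_seq 0\<close>, and coordinate 0 is available because
    \<open>0 < n\<close>.\<close>
  define X where "X y = (\<lambda>x\<in>?V. seq_scale (x 0) y)" for y
  have X_End: "X y \<in> ?End" if "y \<in> ?V" for y
    using that by (intro T.End_onI)
      (simp_all add: X_def T.V_closed seq.scale_left_distrib, simp_all add: seq_scale_def mult.assoc)
  have X_add: "X (x + y) = (\<lambda>v\<in>?V. X x v + X y v)" for x y
    by (rule ext) (simp add: X_def restrict_def seq.scale_right_distrib)
  have X_scale: "X (seq_scale c y) = (\<lambda>v\<in>?V. seq_scale c (X y v))" for c y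
    by (rule ext) (simp add: X_def restrict_def mult.commute)
  \<comment> \<open>Composing with \<open>f\<close> on the left acts on \<open>X y\<close> through
    \<open>y\<close>; together with multiplicativity of \<open>\<sigma>\<close> this gives the
    intertwining property.\<close>
  have X_comp: "X (f y) = compose ?V f (X y)" if "f \<in> ?End" "y \<in> ?V" for f y
    by (rule ext) (simp add: X_def compose_def restrict_def T.End_on_scale[OF that])
  have X_zero: "X 0 \<noteq> X (unit_seq 0)"
  proof
    assume "X 0 = X (unit_seq 0)"
    then have "X 0 (unit_seq 0) 0 = X (unit_seq 0) (unit_seq 0) 0"
      by simp
    moreover have "X 0 (unit_seq 0) 0 = 0"
      by (simp add: X_def unit_seq_in n)
    moreover have "X (unit_seq 0) (unit_seq 0) 0 = 1"
      by (simp add: X_def unit_seq_in n) (simp add: seq_scale_def unit_seq_def)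
    ultimately show False
      by simp
  qed
  have \<sigma>_X_zero: "\<sigma> (X 0) v = 0" if "v \<in> ?V" for v
  proof -
    have "X 0 = (\<lambda>v\<in>?V. seq_scale 0 (X 0 v))"
      using X_scale[of 0 0] by simp
    then have "\<sigma> (X 0) = (\<lambda>v\<in>?V. seq_scale 0 (\<sigma> (X 0) v))"
      using scale[OF X_End, of 0 0] by simp
    then show ?thesis
      using that by (metis restrict_apply' seq.scale_zero_left)
  qed
  have "\<sigma> (X 0) \<noteq> \<sigma> (X (unit_seq 0))"
    using inj_onD[OF bij_betw_imp_inj_on[OF bij] _ X_End X_End] X_zero unit_seq_in[OF n] T.V_zero
    by blast
  \<comment> \<open>Distinct extensional maps differ at a point of the carrier; this point is
    \<open>z\<close>, and \<open>\<sigma> (X 0)\<close> is zero there.\<close>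
  moreover have "\<sigma> (X 0) \<in> extensional ?V" "\<sigma> (X (unit_seq 0)) \<in> extensional ?V"
    using \<sigma>_End[OF X_End] unit_seq_in[OF n] T.V_zero by (auto simp: End_on_def PiE_def)
  ultimately obtain z where z: "z \<in> ?V" "\<sigma> (X (unit_seq 0)) z \<noteq> 0"
    using extensionalityI[of "\<sigma> (X 0)" ?V "\<sigma> (X (unit_seq 0))"] \<sigma>_X_zero by metis
  define K where "K y = \<sigma> (X y) z" for y
  show thesis
  proof (rule that[of K]; (intro allI ballI)?)
    show "K y \<in> ?V" if "y \<in> ?V" for y
      unfolding K_def using \<sigma>_End[OF X_End[OF that]] z(1) by (rule T.End_on_in)
    show "K (x + y) = K x + K y" if "x \<in> ?V" "y \<in> ?V" for x y
      unfolding K_def X_add add[OF X_End[OF that(1)] X_End[OF that(2)]] using z(1) by simp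
    show "K (seq_scale c y) = seq_scale c (K y)" if "y \<in> ?V" for c y
      unfolding K_def X_scale scale[OF X_End[OF that]] using z(1) by simp
    show "K (f y) = \<sigma> f (K y)" if "f \<in> ?End" "y \<in> ?V" for f y
      unfolding K_def X_comp[OF that] mult[OF that(1) X_End[OF that(2)]]
      using z(1) by (simp add: compose_def)
    show "\<exists>y\<in>?V. K y \<noteq> 0"
      using z(2) unit_seq_in[OF n] by (auto simp: K_def)
  qed
qed

section \<open>Existence of a nonzero invariant form\<close>

context coordinates
begin

lemma coordinates_id: "coordinates seq_scale (seq_space n) n (\<lambda>x. x)"
  by unfold_locales (simp_all add: bij_betw_def)

text \<open>The double transpose is \<open>f\<close> carried over by \<open>\<phi>\<close>. In
  identity coordinates the pairing is the symmetric dot product, so the adjoint relation can be used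
  twice.\<close>

lemma coord_apply:
  assumes f: "f \<in> End_on s V" and u: "u \<in> V"
  shows "coordinates.transpose (seq_space n) n (\<lambda>x. x) (transpose f) (\<phi> u) = \<phi> (f u)"
proof -
  interpret I: coordinates seq_scale "seq_space n" n "\<lambda>x. x"
    by (rule coordinates_id)
  have dot: "I.pairing x y = I.pairing y x" for x y
    unfolding I.pairing_def by (intro sum.cong refl mult.commute)
  have pairing: "pairing v x = I.pairing (\<phi> v) x" for v x
    by (simp add: pairing_def I.pairing_def)
  show ?thesis
  proof (rule I.pairing_eqI_right)
    show "I.pairing x (I.transpose (transpose f) (\<phi> u)) = I.pairing x (\<phi> (f u))"
      if x: "x \<in> seq_space n" for x
    proof -
      have "I.pairing x (I.transpose (transpose f) (\<phi> u)) = I.pairing (transpose f x) (\<phi> u)"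
        by (rule I.pairing_transpose[OF transpose_End x coord_in[OF u]])
      also have "\<dots> = pairing u (transpose f x)"
        unfolding pairing by (rule dot)
      also have "\<dots> = pairing (f u) x"
        by (rule pairing_transpose[OF f u x])
      also have "\<dots> = I.pairing x (\<phi> (f u))"
        unfolding pairing by (rule dot)
      finally show ?thesis .
    qed
  qed (simp_all add: I.transpose_in coord_in End_on_in[OF f] u)
qed

text \<open>The hypothesis concerns spaces of sequences, so it is applied to the transpose
  \<open>\<Phi>2\<close> and to the double transpose \<open>\<Phi>1\<close>, which stands in for
  \<open>\<Phi>\<close>. Both live on \<open>seq_space n\<close>.\<close>

lemma nonzero_invariant_form_exists:
  assumes iso: "\<And>(V1 :: (nat \<Rightarrow> 'k) set) (V2 :: (nat \<Rightarrow> 'k) set) \<Phi>1 \<Phi>2.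
       fd_space seq_scale V1 \<Longrightarrow> sharp_td_system seq_scale V1 \<Phi>1 \<Longrightarrow>
       fd_space seq_scale V2 \<Longrightarrow> sharp_td_system seq_scale V2 \<Phi>2 \<Longrightarrow>
       td_isomorphic seq_scale V1 \<Phi>1 seq_scale V2 \<Phi>2 \<longleftrightarrow>
       parameter_array seq_scale V1 \<Phi>1 = parameter_array seq_scale V2 \<Phi>2"
    and n: "0 < n" and sharp: "sharp_td_system s V \<Phi>"
    and A: "opA \<Phi> \<in> End_on s V" and As: "opAs \<Phi> \<in> End_on s V"
  shows "\<exists>b. nonzero_invariant_form s V \<Phi> b"
proof -
  interpret I: coordinates seq_scale "seq_space n" n "\<lambda>x. x"
    by (rule coordinates_id)
  let ?V = "seq_space n :: (nat \<Rightarrow> 'k) set"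
  define \<Phi>2 where "\<Phi>2 = transpose_td \<Phi>"
  define \<Phi>1 where "\<Phi>1 = I.transpose_td \<Phi>2"
  have ops: "opA \<Phi>2 = transpose (opA \<Phi>)" "opAs \<Phi>2 = transpose (opAs \<Phi>)"
    "opA \<Phi>1 = I.transpose (transpose (opA \<Phi>))" "opAs \<Phi>1 = I.transpose (transpose (opAs \<Phi>))"
    by (simp_all add: \<Phi>1_def \<Phi>2_def transpose_td_def I.transpose_td_def)
  have s2: "sharp_td_system seq_scale ?V \<Phi>2"
    unfolding \<Phi>2_def by (rule sharp_td_system_transpose(1)[OF sharp])
  have s1: "sharp_td_system seq_scale ?V \<Phi>1"
    unfolding \<Phi>1_def by (rule I.sharp_td_system_transpose(1)[OF s2])
  have "parameter_array seq_scale ?V \<Phi>1 = parameter_array seq_scale ?V \<Phi>2"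
    unfolding \<Phi>1_def by (rule I.sharp_td_system_transpose(2)[OF s2])
  then have "td_isomorphic seq_scale ?V \<Phi>1 seq_scale ?V \<Phi>2"
    using iso[OF fd_space_seq[OF n] s1 fd_space_seq[OF n] s2] by blast
  then obtain \<sigma> where \<sigma>: "End_iso seq_scale ?V seq_scale ?V \<sigma>"
    "\<sigma> (opA \<Phi>1) = opA \<Phi>2" "\<sigma> (opAs \<Phi>1) = opAs \<Phi>2"
    unfolding td_isomorphic_def by blast
  obtain K where K: "\<forall>y\<in>?V. K y \<in> ?V"
    "\<forall>x\<in>?V. \<forall>y\<in>?V. K (x + y) = K x + K y"
    "\<forall>c. \<forall>y\<in>?V. K (seq_scale c y) = seq_scale c (K y)"
    "\<forall>f\<in>End_on seq_scale ?V. \<forall>y\<in>?V. K (f y) = \<sigma> f (K y)"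
    "\<exists>y\<in>?V. K y \<noteq> 0"
    by (rule End_iso_intertwiner[OF \<sigma>(1) n])
  note K = K(1-4)[rule_format] K(5)
  \<comment> \<open>\<open>\<phi>\<close> carries \<open>v\<close> to the space of
    \<open>\<Phi>1\<close>, and \<open>K\<close> takes it on to the space of \<open>\<Phi>2\<close>,
    which is the dual of \<open>V\<close>.\<close>
  define b where "b u v = pairing u (K (\<phi> v))" for u v
  have adj: "b (f u) v = b u (f v)"
    if f: "f \<in> End_on s V" and \<sigma>f: "\<sigma> (I.transpose (transpose f)) = transpose f"
      and u: "u \<in> V" and v: "v \<in> V" for f u v
  proof -
    have "b u (f v) = pairing u (K (I.transpose (transpose f) (\<phi> v)))"
      unfolding b_def coord_apply[OF f v] ..
    also have "\<dots> = pairing u (transpose f (K (\<phi> v)))"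
      unfolding K(4)[OF I.transpose_End coord_in[OF v]] \<sigma>f ..
    also have "\<dots> = b (f u) v"
      unfolding b_def by (rule pairing_transpose[OF f u K(1)[OF coord_in[OF v]]])
    finally show ?thesis
      by simp
  qed
  have "bilinear_form s V b"
    by (simp add: bilinear_form_def b_def pairing_add_left pairing_add_right pairing_scale_left
        pairing_scale_right coord_add coord_scale coord_in K(2,3))
  moreover have "\<exists>u\<in>V. \<exists>v\<in>V. b u v \<noteq> 0"
  proof -
    obtain y where y: "y \<in> ?V" "K y \<noteq> 0"
      using K(5) by blast
    obtain v where v: "v \<in> V" "y = \<phi> v"
      using y(1) bij_betw_imp_surj_on[OF bij] by (metis imageE)
    have "\<exists>u\<in>V. pairing u (K y) \<noteq> 0"
      using pairing_eqI_right[OF K(1)[OF y(1)] T.V_zero] y(2) pairing_zero(2) by metis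
    then show ?thesis
      using v by (auto simp: b_def)
  qed
  moreover have "\<forall>u\<in>V. \<forall>v\<in>V. b (opA \<Phi> u) v = b u (opA \<Phi> v) \<and> b (opAs \<Phi> u) v = b u (opAs \<Phi> v)"
    using adj[OF A] adj[OF As] \<sigma>(2,3) unfolding ops by simp
  ultimately show ?thesis
    unfolding nonzero_invariant_form_def by blast
qed

end

theorem theorem11p4:
  fixes s :: "'k::field \<Rightarrow> 'v::ab_group_add \<Rightarrow> 'v"
    and V :: "'v set" and \<Phi> :: "'v td_data"
  assumes "\<And>(V1 :: (nat \<Rightarrow> 'k) set) (V2 :: (nat \<Rightarrow> 'k) set) \<Phi>1 \<Phi>2.
       fd_space seq_scale V1 \<Longrightarrow> sharp_td_system seq_scale V1 \<Phi>1 \<Longrightarrow>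
       fd_space seq_scale V2 \<Longrightarrow> sharp_td_system seq_scale V2 \<Phi>2 \<Longrightarrow>
       td_isomorphic seq_scale V1 \<Phi>1 seq_scale V2 \<Phi>2 \<longleftrightarrow>
       parameter_array seq_scale V1 \<Phi>1 = parameter_array seq_scale V2 \<Phi>2"
    and "fd_space s V"
    and "sharp_td_system s V \<Phi>"
  shows "(\<exists>b. nonzero_invariant_form s V \<Phi> b) \<and>
    (\<forall>b b'. nonzero_invariant_form s V \<Phi> b \<and> nonzero_invariant_form s V \<Phi> b' \<longrightarrow>
       (\<exists>c. c \<noteq> 0 \<and> (\<forall>u\<in>V. \<forall>v\<in>V. b' u v = c * b u v))) \<and>
    (\<forall>b. nonzero_invariant_form s V \<Phi> b \<longrightarrow> nondegenerate_form V b \<and> symmetric_form V b)"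
proof -
  obtain n \<phi> where n: "0 < n" and coord: "coordinates s V n \<phi>"
    by (rule coordinates_exist[OF assms(2)])
  interpret C: coordinates s V n \<phi>
    by (rule coord)
  have td: "td_system s V \<Phi>" and dim: "C.dim (idE \<Phi> 0 ` V) = 1"
    using assms(3) by (simp_all add: sharp_td_system_def)
  obtain \<theta> \<theta>' where P: "td_resolution s V \<Phi> \<theta> \<theta>'"
    using td_system_imp_resolution[OF C.carrier_space_axioms td] by (elim exE)
  interpret P: td_resolution s V \<Phi> \<theta> \<theta>'
    by (rule P)
  show ?thesis
  proof (intro conjI allI impI)
    show "\<exists>b. nonzero_invariant_form s V \<Phi> b"
      using assms(1) n assms(3) P.R.A_End P.S.A_End by (rule C.nonzero_invariant_form_exists)
  next
    fix b b'
    assume "nonzero_invariant_form s V \<Phi> b \<and> nonzero_invariant_form s V \<Phi> b'"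
    then show "\<exists>c. c \<noteq> 0 \<and> (\<forall>u\<in>V. \<forall>v\<in>V. b' u v = c * b u v)"
      using P.form_unique[OF dim] by simp
  next
    fix b
    assume b: "nonzero_invariant_form s V \<Phi> b"
    show "nondegenerate_form V b"
      by (rule P.nondegenerate[OF b])
    show "symmetric_form V b"
      by (rule P.form_symmetric[OF dim b])
  qed
qed

end
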